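(* Let $0<\sigma_1^2<\sigma_2^2$, assume Assumption (A) stated in the context, and let $c$ be a real number with $0\le c \le c(\sigma_1^2,\sigma_2^2)$. Then \[ \lim_{n \to \infty} \frac{C_s(\sigma_1^2, \sigma_2^2, c \sqrt{n},n )}{n} = \frac{1}{2} \log \left( \frac{1+c^2/\sigma_1^2}{ 1+c^2/\sigma_2^2} \right). \]
   Context: Vector Gaussian wiretap channel in dimension $n$: $\mathbf{Y}_1=\mathbf{X}+\mathbf{N}_1$, $\mathbf{Y}_2=\mathbf{X}+\mathbf{N}_2$, $\mathbf{N}_1\sim\mathcal{N}(\mathbf{0}_n,\sigma_1^2\mathbf{I}_n)$, $\mathbf{N}_2\sim\mathcal{N}(\mathbf{0}_n,\sigma_2^2\mathbf{I}_n)$, mutually independent with $\mathbf{X}\in\mathbb{R}^n$. $C_s(\sigma_1^2,\sigma_2^2,\mathsf{R},n)=\max I(\mathbf{X};\mathbf{Y}_1)-I(\mathbf{X};\mathbf{Y}_2)$ over distributions of $\mathbf{X}$ supported in $\{\|\mathbf{x}\|\le\mathsf{R}\}$. $c(\sigma_1^2,\sigma_2^2)$ denotes the solution $c$ of $\int_{\sigma_1^2}^{\sigma_2^2} \frac{ \frac{c^2 }{ ( \frac{\sqrt{s}}{2}+\sqrt{ \frac{s}{4} + c^2} )^2} + \frac{ c^2 (c^2+ s)}{ ( \frac{s}{2}+\sqrt{ \frac{s^2}{4} +c^2( c^2+ s) } )^2} -1}{s^2} \mathrm{d} s =0$. $\mathsf{h}_v(x)=\mathsf{I}_v(x)/\mathsf{I}_{v-1}(x)$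 with $\mathsf{I}_v$ the modified Bessel function of the first kind. Assumption (A): for all $\mathsf{R}\ge0$, $0\le\sigma_1\le\sigma_2$, $n\in\mathbb{N}$, the function $y\mapsto \frac{1}{\sigma_2^2}\mathbb{E}\left[\frac{\mathsf{R}}{\|y\mathbf{e}_1+\mathbf{W}\|}\mathsf{h}_{\frac{n}{2}}\left(\frac{\mathsf{R}}{\sigma_2^2}\|y\mathbf{e}_1+\mathbf{W}\|\right)-1\right]-\frac{1}{\sigma_1^2}\left(\frac{\mathsf{R}}{y}\mathsf{h}_{\frac{n}{2}}\left(\frac{\mathsf{R}}{\sigma_1^2}y\right)-1\right)$ has at most one sign change on $y>0$, where $\mathbf{W}\sim\mathcal{N}(\mathbf{0}_{n+2},(\sigma_2^2-\sigma_1^2)\mathbf{I}_{n+2})$ and $\mathbf{e}_1$ is the first unit vector of $\mathbb{R}^{n+2}$. *)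

theory Defs
  imports "HOL-Analysis.Analysis" "HOL-Probability.Probability"
begin

definition euc :: "nat \<Rightarrow> (nat \<Rightarrow> real) measure" where
  "euc n = PiM {..<n} (\<lambda>_. lborel)"

definition vnorm :: "nat \<Rightarrow> (nat \<Rightarrow> real) \<Rightarrow> real" where
  "vnorm n x = sqrt (\<Sum>i<n. (x i)\<^sup>2)"

text \<open>Gaussian vector N(0, v I_n), v = variance (normal_density takes the standard deviation).\<close>
definition gauss_vec :: "nat \<Rightarrow> real \<Rightarrow> (nat \<Rightarrow> real) measure" where
  "gauss_vec n v = PiM {..<n} (\<lambda>_. density lborel (normal_density 0 (sqrt v)))"

definition admissible_input :: "nat \<Rightarrow> real \<Rightarrow> (nat \<Rightarrow> real) measure \<Rightarrow> bool" where
  "admissible_input n R P \<longleftrightarrow> prob_space P \<and> sets P = sets (euc n) \<and> (AE x in P. vnorm n x \<le> R)"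

text \<open>I(X;Y) in nats, where X ~ P and Y = X + N, N ~ N(0, v I_n) independent of X.
  The joint law of (X,N) is the product measure P x N(0,vI_n).\<close>
definition chan_MI :: "nat \<Rightarrow> real \<Rightarrow> (nat \<Rightarrow> real) measure \<Rightarrow> real" where
  "chan_MI n v P = prob_space.mutual_information (P \<Otimes>\<^sub>M gauss_vec n v) (exp 1) (euc n) (euc n)
      fst (\<lambda>(x, z). restrict (\<lambda>i. x i + z i) {..<n})"

definition Cs :: "real \<Rightarrow> real \<Rightarrow> real \<Rightarrow> nat \<Rightarrow> real" where
  "Cs v1 v2 R n = Sup ((\<lambda>P. chan_MI n v1 P - chan_MI n v2 P) ` {P. admissible_input n R P})"

definition cint :: "real \<Rightarrow> real \<Rightarrow> real" where
  "cint c s = ((c\<^sup>2 / (sqrt s / 2 + sqrt (s / 4 + c\<^sup>2))\<^sup>2)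
     + (c\<^sup>2 * (c\<^sup>2 + s) / (s / 2 + sqrt (s\<^sup>2 / 4 + c\<^sup>2 * (c\<^sup>2 + s)))\<^sup>2) - 1) / s\<^sup>2"

definition cstar :: "real \<Rightarrow> real \<Rightarrow> real" where
  "cstar v1 v2 = (THE c. c > 0 \<and> integral {v1..v2} (cint c) = 0)"

definition besselI :: "real \<Rightarrow> real \<Rightarrow> real" where
  "besselI v x = (\<Sum>k. (x / 2) powr (2 * real k + v) / (fact k * Gamma (real k + v + 1)))"

definition besselh :: "real \<Rightarrow> real \<Rightarrow> real" where
  "besselh v x = besselI v x / besselI (v - 1) x"

definition at_most_one_sign_change :: "(real \<Rightarrow> real) \<Rightarrow> bool" where
  "at_most_one_sign_change f \<longleftrightarrow>
     \<not> (\<exists>y1 y2 y3. 0 < y1 \<and> y1 < y2 \<and> y2 < y3 \<and> f y1 * f y2 < 0 \<and> f y2 * f y3 < 0)"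

text \<open>The function of Assumption (A); s1, s2 are standard deviations sigma_1, sigma_2.
  W ~ N(0,(s2^2 - s1^2) I_{n+2}), indexed by {..<n+2}; e_1 is coordinate 0.\<close>
definition assmA_fun :: "real \<Rightarrow> real \<Rightarrow> real \<Rightarrow> nat \<Rightarrow> real \<Rightarrow> real" where
  "assmA_fun R s1 s2 n y =
     1 / s2\<^sup>2 * (\<integral>w. (let t = sqrt ((y + w 0)\<^sup>2 + (\<Sum>i\<in>{1..<n+2}. (w i)\<^sup>2))
                      in R / t * besselh (real n / 2) (R / s2\<^sup>2 * t) - 1)
                  \<partial>gauss_vec (n + 2) (s2\<^sup>2 - s1\<^sup>2))
     - 1 / s1\<^sup>2 * (R / y * besselh (real n / 2) (R / s1\<^sup>2 * y) - 1)"

definition assumption_A :: bool where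
  "assumption_A \<longleftrightarrow> (\<forall>R s1 s2 n. 0 \<le> R \<and> 0 < s1 \<and> s1 < s2 \<and> 1 \<le> n \<longrightarrow>
      at_most_one_sign_change (assmA_fun R s1 s2 n))"

end

theory Submission
  imports Defs
begin

text \<open>The limit holds because the average-power secrecy capacity
  \<open>n/2 ln ((1 + c\<^sup>2/v\<^sub>1) / (1 + c\<^sup>2/v\<^sub>2))\<close> bounds \<open>C\<^sub>s\<close> from above for every \<open>n\<close>, while a Gaussian input
  of variance \<open>t < c\<^sup>2\<close> conditioned on the ball of radius \<open>c \<surd>n\<close> loses only \<open>O(1)\<close> against the
  unconditioned one.

  Upper bound: with \<open>Y\<^sub>2 = Y\<^sub>1 + N'\<close> the entropy increment \<open>h(Y\<^sub>2) - h(Y\<^sub>1)\<close> is bounded from below by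
  comparing the law of \<open>(Y\<^sub>1, Y\<^sub>2)\<close> with a law under which \<open>Y\<^sub>1\<close> given \<open>Y\<^sub>2\<close> is Gaussian around its linear
  least-squares estimate.

  Lower bound: the ball has probability at least \<open>1/2\<close> by Chebyshev's inequality, so the output density is
  at most twice a Gaussian density. This bounds \<open>h(Y\<^sub>1)\<close> from below; \<open>h(Y\<^sub>2)\<close> is bounded from above by the
  maximum-entropy property of Gaussians.\<close>

section \<open>Gaussian kernels on finite products\<close>

definition gauss_kernel :: "nat \<Rightarrow> real \<Rightarrow> (nat \<Rightarrow> real) \<Rightarrow> (nat \<Rightarrow> real) \<Rightarrow> real" where
  "gauss_kernel n v x y = (\<Prod>i<n. normal_density (x i) (sqrt v) (y i))"

text \<open>Only coordinates below \<open>n\<close> enter, so the constant zero function may serve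
  as the origin although it is not extensional and hence need not be a point of
  \<open>space (euc n)\<close>.\<close>

definition sqdist :: "nat \<Rightarrow> (nat \<Rightarrow> real) \<Rightarrow> (nat \<Rightarrow> real) \<Rightarrow> real" where
  "sqdist n x y = (\<Sum>i<n. (y i - x i)\<^sup>2)"

lemma sqdist_nonneg: "0 \<le> sqdist n x y"
  by (simp add: sqdist_def sum_nonneg)

lemma sqdist_commute: "sqdist n x y = sqdist n y x"
  by (simp add: sqdist_def power2_commute)

lemma vnorm_le_iff: "0 \<le> R \<Longrightarrow> vnorm n x \<le> R \<longleftrightarrow> sqdist n (\<lambda>_. 0) x \<le> R\<^sup>2"
  unfolding vnorm_def sqdist_def diff_zero by (metis real_sqrt_abs abs_of_nonneg real_sqrt_le_iff)

lemma sqdist_le: "sqdist n x y \<le> 2 * sqdist n (\<lambda>_. 0) x + 2 * sqdist n (\<lambda>_. 0) y"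
proof -
  have "(b - a)\<^sup>2 \<le> 2 * a\<^sup>2 + 2 * b\<^sup>2" for a b :: real
    using zero_le_power2[of "a + b"] by (simp add: power2_eq_square algebra_simps)
  then have "sqdist n x y \<le> (\<Sum>i<n. 2 * (x i)\<^sup>2 + 2 * (y i)\<^sup>2)"
    unfolding sqdist_def by (intro sum_mono)
  then show ?thesis by (simp add: sqdist_def sum.distrib sum_distrib_left)
qed

text \<open>With the normalising constant moved into the exponent, the logarithm is affine in
  \<open>sqdist\<close>; every entropy computation then reduces to second moments.\<close>

lemma gauss_kernel_eq:
  assumes "0 < v"
  shows "gauss_kernel n v x y = exp (- (real n / 2 * ln (2 * pi * v)) - sqdist n x y / (2 * v))"
proof -
  have *: "normal_density a (sqrt v) b = exp (- (ln (2 * pi * v) / 2) - (b - a)\<^sup>2 / (2 * v))" for a b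
  proof -
    have "1 / sqrt (2 * pi * v) = exp (- (ln (2 * pi * v) / 2))"
      using assms by (simp add: exp_minus inverse_eq_divide flip: ln_sqrt)
    then have "normal_density a (sqrt v) b = exp (- (ln (2 * pi * v) / 2)) * exp (- (b - a)\<^sup>2 / (2 * v))"
      using assms by (simp only: normal_density_def real_sqrt_pow2 less_imp_le)
    then show ?thesis by (simp only: exp_add[symmetric]) simp
  qed
  show ?thesis
    unfolding gauss_kernel_def * exp_sum[OF finite_lessThan, symmetric] sqdist_def
    by (simp only: sum_subtractf sum_divide_distrib[symmetric]) simp
qed

lemma gauss_kernel_pos: "0 < v \<Longrightarrow> 0 < gauss_kernel n v x y"
  by (simp add: gauss_kernel_eq)

lemma ln_gauss_kernel:
  "0 < v \<Longrightarrow> ln (gauss_kernel n v x y) = - (real n / 2 * ln (2 * pi * v)) - sqdist n x y / (2 * v)"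
  by (simp add: gauss_kernel_eq)

lemma gauss_kernel_le: "0 < v \<Longrightarrow> gauss_kernel n v x y \<le> exp (- (real n / 2 * ln (2 * pi * v)))"
  by (simp add: gauss_kernel_eq sqdist_nonneg)

lemma space_euc: "space (euc n) = extensional {..<n}"
  by (simp add: euc_def space_PiM PiE_def)

lemma measurable_euc_component [measurable]: "i < n \<Longrightarrow> (\<lambda>x. x i) \<in> borel_measurable (euc n)"
  unfolding euc_def by (rule measurable_component_singleton[where M="\<lambda>_. lborel", simplified]) auto

lemma sqdist_measurable [measurable]:
  assumes "\<And>i. i < n \<Longrightarrow> (\<lambda>w. f w i) \<in> borel_measurable M" "\<And>i. i < n \<Longrightarrow> (\<lambda>w. g w i) \<in> borel_measurable M"
  shows "(\<lambda>w. sqdist n (f w) (g w)) \<in> borel_measurable M"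
  unfolding sqdist_def using assms by (intro borel_measurable_sum) auto

lemma gauss_kernel_measurable [measurable]:
  assumes "\<And>i. i < n \<Longrightarrow> (\<lambda>w. f w i) \<in> borel_measurable M" "\<And>i. i < n \<Longrightarrow> (\<lambda>w. g w i) \<in> borel_measurable M"
  shows "(\<lambda>w. gauss_kernel n v (f w) (g w)) \<in> borel_measurable M"
  unfolding gauss_kernel_def normal_density_def using assms by (intro borel_measurable_prod) auto

section \<open>Mass, moments and convolution of the Gaussian kernel\<close>

lemma prod_sigma_finite_lborel: "product_sigma_finite (\<lambda>_::nat. lborel :: real measure)"
  by standard

lemma sigma_finite_euc: "sigma_finite_measure (euc n)"
  unfolding euc_def by (rule product_sigma_finite.sigma_finite[OF prod_sigma_finite_lborel]) simp

text \<open>Tonelli on the product measure. Later Gaussian integrals arise by choosing the factors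
  \<open>h i\<close>: constants, squares of one or two coordinates, a second kernel, or indicators
  of the sides of a box.\<close>

lemma nn_integral_gauss_kernel_prod:
  assumes [measurable]: "\<And>i. i < n \<Longrightarrow> h i \<in> borel_measurable borel"
  shows "(\<integral>\<^sup>+y. (\<Prod>i<n. h i (y i)) * ennreal (gauss_kernel n v x y) \<partial>euc n)
    = (\<Prod>i<n. \<integral>\<^sup>+t. h i t * ennreal (normal_density (x i) (sqrt v) t) \<partial>lborel)"
proof -
  have "(\<integral>\<^sup>+y. (\<Prod>i<n. h i (y i)) * ennreal (gauss_kernel n v x y) \<partial>euc n)
      = (\<integral>\<^sup>+y. (\<Prod>i<n. h i (y i) * ennreal (normal_density (x i) (sqrt v) (y i))) \<partial>euc n)"
    by (simp add: gauss_kernel_def prod_ennreal[symmetric] prod.distrib)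
  also have "\<dots> = (\<Prod>i<n. \<integral>\<^sup>+t. h i t * ennreal (normal_density (x i) (sqrt v) t) \<partial>lborel)"
    unfolding euc_def
    by (rule product_sigma_finite.product_nn_integral_prod[OF prod_sigma_finite_lborel]) auto
  finally show ?thesis .
qed

lemma nn_integral_normal_density:
  "0 < s \<Longrightarrow> (\<integral>\<^sup>+t. ennreal (normal_density a s t) \<partial>lborel) = 1"
  by (subst nn_integral_eq_integral) auto

lemma nn_integral_gauss_kernel:
  "0 < v \<Longrightarrow> (\<integral>\<^sup>+y. ennreal (gauss_kernel n v x y) \<partial>euc n) = 1"
  using nn_integral_gauss_kernel_prod[of n "\<lambda>_ _. 1" v x] by (simp add: nn_integral_normal_density)

text \<open>Expand \<open>t - b = (t - a) + (a - b)\<close>: the cross term vanishes with the first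
  central moment, leaving the variance and the squared offset.\<close>

lemma nn_integral_normal_density_square:
  assumes "0 < v"
  shows "(\<integral>\<^sup>+t. ennreal ((t - b)\<^sup>2) * ennreal (normal_density a (sqrt v) t) \<partial>lborel) = ennreal (v + (a - b)\<^sup>2)"
proof -
  have s: "0 < sqrt v" using assms by simp
  have 2: "has_bochner_integral lborel (\<lambda>t. normal_density a (sqrt v) t * (t - a)\<^sup>2) v"
    using normal_moment_even[OF s, of a 1] assms by simp
  have 1: "has_bochner_integral lborel (\<lambda>t. normal_density a (sqrt v) t * (t - a)) 0"
    using normal_moment_odd[OF s, of a 0] by simp
  have 0: "has_bochner_integral lborel (\<lambda>t. normal_density a (sqrt v) t) 1"
    using normal_moment_even[OF s, of a 0] by simp
  have "has_bochner_integral lborel (\<lambda>t. normal_density a (sqrt v) t * (t - a)\<^sup>2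
       + (2 * (a - b)) * (normal_density a (sqrt v) t * (t - a)) + (a - b)\<^sup>2 * normal_density a (sqrt v) t)
       (v + 2 * (a - b) * 0 + (a - b)\<^sup>2 * 1)"
    by (intro has_bochner_integral_add has_bochner_integral_mult_right 0 1 2)
  then have *: "has_bochner_integral lborel (\<lambda>t. (t - b)\<^sup>2 * normal_density a (sqrt v) t) (v + (a - b)\<^sup>2)"
    by (rule has_bochner_integral_cong[THEN iffD1, rotated -1]) (auto simp: power2_eq_square algebra_simps)
  show ?thesis
    unfolding ennreal_mult[symmetric, OF zero_le_power2 normal_density_nonneg]
    using * by (subst nn_integral_eq_integral) (auto simp: has_bochner_integral_iff)
qed

lemma nn_integral_gauss_kernel_sqdist:
  assumes "0 < v"
  shows "(\<integral>\<^sup>+y. ennreal (sqdist n b y) * ennreal (gauss_kernel n v x y) \<partial>euc n) = ennreal (n * v + sqdist n b x)"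
proof -
  have *: "(\<integral>\<^sup>+y. ennreal ((y i - b i)\<^sup>2) * ennreal (gauss_kernel n v x y) \<partial>euc n) = ennreal (v + (x i - b i)\<^sup>2)"
    if "i < n" for i
  proof -
    have "(\<integral>\<^sup>+y. ennreal ((y i - b i)\<^sup>2) * ennreal (gauss_kernel n v x y) \<partial>euc n)
      = (\<integral>\<^sup>+y. (\<Prod>j<n. (if j = i then ennreal ((y j - b j)\<^sup>2) else 1)) * ennreal (gauss_kernel n v x y) \<partial>euc n)"
      using that by (simp add: prod.delta)
    also have "\<dots> = (\<Prod>j<n. \<integral>\<^sup>+t. (if j = i then ennreal ((t - b j)\<^sup>2) else 1) * ennreal (normal_density (x j) (sqrt v) t) \<partial>lborel)"
      by (rule nn_integral_gauss_kernel_prod[where h="\<lambda>j t. if j = i then ennreal ((t - b j)\<^sup>2) else 1"]) auto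
    also have "\<dots> = (\<Prod>j<n. if j = i then ennreal (v + (x j - b j)\<^sup>2) else 1)"
      using assms by (intro prod.cong) (auto simp: nn_integral_normal_density nn_integral_normal_density_square)
    finally show ?thesis using that by (simp add: prod.delta)
  qed
  have "(\<integral>\<^sup>+y. ennreal (sqdist n b y) * ennreal (gauss_kernel n v x y) \<partial>euc n)
     = (\<integral>\<^sup>+y. (\<Sum>i<n. ennreal ((y i - b i)\<^sup>2) * ennreal (gauss_kernel n v x y)) \<partial>euc n)"
    by (simp add: sqdist_def sum_ennreal[symmetric] sum_distrib_right del: sum_ennreal)
  also have "\<dots> = (\<Sum>i<n. ennreal (v + (x i - b i)\<^sup>2))"
    by (subst nn_integral_sum) (auto simp: *)
  also have "\<dots> = ennreal (n * v + sqdist n b x)"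
    using assms by (simp add: sum.distrib sqdist_def sum_nonneg ennreal_mult ennreal_of_nat_eq_real_of_nat)
  finally show ?thesis .
qed

text \<open>Variances add coordinatewise; a shift by \<open>x i\<close> reduces each factor to the
  convolution of two centred normal densities. This is the semigroup property behind writing the
  noisier output as the better one plus independent noise.\<close>

lemma nn_integral_gauss_kernel_conv:
  assumes "0 < v" "0 < w"
  shows "(\<integral>\<^sup>+y. ennreal (gauss_kernel n v x y) * ennreal (gauss_kernel n w y z) \<partial>euc n) = ennreal (gauss_kernel n (v + w) x z)"
proof -
  have *: "(\<integral>\<^sup>+t. ennreal (normal_density t (sqrt w) (z i)) * ennreal (normal_density (x i) (sqrt v) t) \<partial>lborel)
     = ennreal (normal_density (x i) (sqrt (v + w)) (z i))" for i
  proof -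
    have "(\<integral>\<^sup>+t. ennreal (normal_density t (sqrt w) (z i)) * ennreal (normal_density (x i) (sqrt v) t) \<partial>lborel)
       = (\<integral>\<^sup>+t. ennreal (normal_density 0 (sqrt w) (z i - x i - t) * normal_density 0 (sqrt v) t) \<partial>lborel)"
      by (subst nn_integral_real_affine[where c=1 and t="x i"])
         (auto simp: normal_density_def ennreal_mult[symmetric] algebra_simps intro!: nn_integral_cong)
    also have "\<dots> = ennreal (normal_density 0 (sqrt (v + w)) (z i - x i))"
      using fun_cong[OF conv_normal_density_zero_mean[of "sqrt w" "sqrt v"], of "z i - x i"] assms
      by (simp add: add.commute)
    finally show ?thesis by (simp add: normal_density_def)
  qed
  have "(\<integral>\<^sup>+y. ennreal (gauss_kernel n v x y) * ennreal (gauss_kernel n w y z) \<partial>euc n)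
    = (\<integral>\<^sup>+y. (\<Prod>i<n. ennreal (normal_density (y i) (sqrt w) (z i))) * ennreal (gauss_kernel n v x y) \<partial>euc n)"
    by (simp add: gauss_kernel_def prod_ennreal mult.commute)
  also have "\<dots> = (\<Prod>i<n. ennreal (normal_density (x i) (sqrt (v + w)) (z i)))"
    unfolding *[symmetric]
    by (rule nn_integral_gauss_kernel_prod[where h="\<lambda>i t. ennreal (normal_density t (sqrt w) (z i))"]) (auto simp: normal_density_def)
  finally show ?thesis by (simp add: gauss_kernel_def prod_ennreal)
qed

section \<open>Gaussian product measures as kernel densities\<close>

lemma PiM_normal_density_eqI:
  assumes "sets M = sets (euc n)" "0 < v"
    and "\<And>A. (\<And>i. i < n \<Longrightarrow> A i \<in> sets borel) \<Longrightarrow> emeasure M (Pi\<^sub>E {..<n} A)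
      = (\<Prod>i<n. \<integral>\<^sup>+t. indicator (A i) t * ennreal (normal_density (x i) (sqrt v) t) \<partial>lborel)"
  shows "M = PiM {..<n} (\<lambda>i. density lborel (normal_density (x i) (sqrt v)))"
proof (rule product_sigma_finite.PiM_eqI)
  show "product_sigma_finite (\<lambda>i. density lborel (\<lambda>t. ennreal (normal_density (x i) (sqrt v) t)))"
    using assms(2) by (intro product_sigma_finite.intro prob_space_imp_sigma_finite prob_space_normal_density) auto
  show "sets M = sets (Pi\<^sub>M {..<n} (\<lambda>i. density lborel (\<lambda>t. ennreal (normal_density (x i) (sqrt v) t))))"
    unfolding assms(1) euc_def by (intro sets_PiM_cong) auto
qed (use assms(3) in \<open>auto simp: emeasure_density mult.commute\<close>)

text \<open>This is the conditional law of the output given the input \<open>x\<close>. Both sides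
  are identified with the same product measure, which is determined by its values on boxes.\<close>

lemma distr_gauss_vec_translate:
  assumes "0 < v"
  shows "distr (gauss_vec n v) (euc n) (\<lambda>z. restrict (\<lambda>i. x i + z i) {..<n}) = density (euc n) (\<lambda>y. ennreal (gauss_kernel n v x y))"
proof -
  have box: "emeasure (density (euc n) (\<lambda>y. ennreal (gauss_kernel n v x y))) (Pi\<^sub>E {..<n} A)
      = (\<Prod>i<n. \<integral>\<^sup>+t. indicator (A i) t * ennreal (normal_density (x i) (sqrt v) t) \<partial>lborel)"
    if A: "\<And>i. i < n \<Longrightarrow> A i \<in> sets borel" for A and x :: "nat \<Rightarrow> real"
  proof -
    have [measurable]: "Pi\<^sub>E {..<n} A \<in> sets (euc n)"
      unfolding euc_def using A by (intro sets_PiM_I_finite) auto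
    have "emeasure (density (euc n) (\<lambda>y. ennreal (gauss_kernel n v x y))) (Pi\<^sub>E {..<n} A)
      = (\<integral>\<^sup>+y. (\<Prod>i<n. indicator (A i) (y i)) * ennreal (gauss_kernel n v x y) \<partial>euc n)"
    proof (subst emeasure_density)
      have "indicator (Pi\<^sub>E {..<n} A) y = (\<Prod>i<n. indicator (A i) (y i) :: ennreal)" if y: "y \<in> space (euc n)" for y
      proof (cases "y \<in> Pi\<^sub>E {..<n} A")
        case True
        then have "(\<Prod>i<n. indicator (A i) (y i) :: ennreal) = 1"
          by (intro prod.neutral) (auto simp: PiE_iff)
        then show ?thesis using True by simp
      next
        case False
        then obtain i where "i < n" "y i \<notin> A i"
          using y by (auto simp: space_euc PiE_iff)
        then have "(\<Prod>i<n. indicator (A i) (y i) :: ennreal) = 0"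
          by (intro prod_zero) (auto intro!: bexI[of _ i])
        then show ?thesis using False by simp
      qed
      then show "(\<integral>\<^sup>+y. ennreal (gauss_kernel n v x y) * indicator (Pi\<^sub>E {..<n} A) y \<partial>euc n)
        = (\<integral>\<^sup>+y. (\<Prod>i<n. indicator (A i) (y i)) * ennreal (gauss_kernel n v x y) \<partial>euc n)"
        by (intro nn_integral_cong) (simp add: mult.commute)
    qed simp_all
    also have "\<dots> = (\<Prod>i<n. \<integral>\<^sup>+t. indicator (A i) t * ennreal (normal_density (x i) (sqrt v) t) \<partial>lborel)"
      using A by (intro nn_integral_gauss_kernel_prod) auto
    finally show ?thesis .
  qed
  have D: "density (euc n) (\<lambda>y. ennreal (gauss_kernel n v x y))
      = PiM {..<n} (\<lambda>i. density lborel (normal_density (x i) (sqrt v)))" for x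
    by (rule PiM_normal_density_eqI) (use assms box in auto)
  have G: "gauss_vec n v = density (euc n) (\<lambda>y. ennreal (gauss_kernel n v (\<lambda>_. 0) y))"
    unfolding gauss_vec_def D ..
  show ?thesis
    unfolding D
  proof (rule PiM_normal_density_eqI)
    fix A assume A: "\<And>i. i < n \<Longrightarrow> A i \<in> sets (borel :: real measure)"
    let ?T = "\<lambda>z. restrict (\<lambda>i. x i + z i) {..<n}"
    have [measurable]: "Pi\<^sub>E {..<n} A \<in> sets (euc n)"
      unfolding euc_def using A by (intro sets_PiM_I_finite) auto
    have T [measurable]: "?T \<in> gauss_vec n v \<rightarrow>\<^sub>M euc n"
      unfolding G by (subst euc_def) (rule measurable_restrict, simp)
    \<comment> \<open>The preimage of a box under a translation is again a box: points of the space
      are extensional, so no condition arises outside \<open>{..<n}\<close>.\<close>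
    have vim: "?T -` Pi\<^sub>E {..<n} A \<inter> space (gauss_vec n v) = Pi\<^sub>E {..<n} (\<lambda>i. {z. x i + z \<in> A i})"
      unfolding G by (auto simp: space_euc PiE_def extensional_def Pi_def)
    have B: "{z. x i + z \<in> A i} \<in> sets borel" if "i < n" for i
      using measurable_sets[OF _ A[OF that], of "\<lambda>z. x i + z" borel] by (simp add: vimage_def)
    have "emeasure (distr (gauss_vec n v) (euc n) ?T) (Pi\<^sub>E {..<n} A)
      = (\<Prod>i<n. \<integral>\<^sup>+t. indicator {z. x i + z \<in> A i} t * ennreal (normal_density 0 (sqrt v) t) \<partial>lborel)"
      by (subst emeasure_distr[OF T]) (auto simp: vim, auto simp: G box B)
    also have "\<dots> = (\<Prod>i<n. \<integral>\<^sup>+t. indicator (A i) t * ennreal (normal_density (x i) (sqrt v) t) \<partial>lborel)"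
    proof (rule prod.cong[OF refl])
      fix i assume "i \<in> {..<n}"
      then have [measurable]: "A i \<in> sets borel" using A by auto
      show "(\<integral>\<^sup>+t. indicator {z. x i + z \<in> A i} t * ennreal (normal_density 0 (sqrt v) t) \<partial>lborel)
        = (\<integral>\<^sup>+t. indicator (A i) t * ennreal (normal_density (x i) (sqrt v) t) \<partial>lborel)"
        by (subst (2) nn_integral_real_affine[where c=1 and t="x i"])
           (auto simp: normal_density_def indicator_def intro!: nn_integral_cong)
    qed
    finally show "emeasure (distr (gauss_vec n v) (euc n) ?T) (Pi\<^sub>E {..<n} A)
      = (\<Prod>i<n. \<integral>\<^sup>+t. indicator (A i) t * ennreal (normal_density (x i) (sqrt v) t) \<partial>lborel)" .
  qed (use assms in auto)
qed

lemma gauss_vec_eq_density: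
  assumes "0 < v"
  shows "gauss_vec n v = density (euc n) (\<lambda>y. ennreal (gauss_kernel n v (\<lambda>_. 0) y))"
proof -
  \<comment> \<open>Translation by \<open>0\<close> is the identity here, because points of the
    noise space are already extensional on \<open>{..<n}\<close>.\<close>
  have G: "gauss_vec n v = distr (gauss_vec n v) (euc n) (\<lambda>z. restrict (\<lambda>i. 0 + z i) {..<n})"
    unfolding gauss_vec_def euc_def
    by (rule distr_id2[symmetric, THEN trans])
       (auto intro!: distr_cong sets_PiM_cong simp: space_PiM restrict_PiE_iff PiE_def extensional_restrict)
  then show ?thesis using distr_gauss_vec_translate[OF assms, of n "\<lambda>_. 0"] by simp
qed

section \<open>The Gaussian channel\<close>

text \<open>A density form of the law of input and output, to which Tonelli applies directly;
  \<open>joint_law_eq_distr\<close> matches it with the push-forward occurring in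
  \<open>chan_MI\<close>.\<close>

definition joint_law :: "nat \<Rightarrow> real \<Rightarrow> (nat \<Rightarrow> real) measure \<Rightarrow> ((nat \<Rightarrow> real) \<times> (nat \<Rightarrow> real)) measure" where
  "joint_law n v Q = density (Q \<Otimes>\<^sub>M euc n) (\<lambda>(x, y). ennreal (gauss_kernel n v x y))"

definition out_density :: "nat \<Rightarrow> real \<Rightarrow> (nat \<Rightarrow> real) measure \<Rightarrow> (nat \<Rightarrow> real) \<Rightarrow> real" where
  "out_density n v Q y = (\<integral>x. gauss_kernel n v x y \<partial>Q)"

definition out_law :: "nat \<Rightarrow> real \<Rightarrow> (nat \<Rightarrow> real) measure \<Rightarrow> (nat \<Rightarrow> real) measure" where
  "out_law n v Q = density (euc n) (\<lambda>y. ennreal (out_density n v Q y))"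

text \<open>Differential entropy in nats, written as an expectation under the output law so that
  moment bounds settle integrability.\<close>

definition out_entropy :: "nat \<Rightarrow> real \<Rightarrow> (nat \<Rightarrow> real) measure \<Rightarrow> real" where
  "out_entropy n v Q = - (\<integral>y. ln (out_density n v Q y) \<partial>out_law n v Q)"

definition second_moment :: "nat \<Rightarrow> (nat \<Rightarrow> real) measure \<Rightarrow> real" where
  "second_moment n Q = (\<integral>x. sqdist n (\<lambda>_. 0) x \<partial>Q)"

text \<open>Gibbs' inequality, from \<open>ln r <= r - 1\<close>. In its applications
  \<open>r\<close> is a likelihood ratio, reference density over true density.\<close>

lemma integral_ln_nonpos:
  fixes r :: "'a \<Rightarrow> real"
  assumes "prob_space M" and [measurable]: "r \<in> borel_measurable M" and pos: "\<And>x. x \<in> space M \<Longrightarrow> 0 < r x"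
    and le: "(\<integral>\<^sup>+x. ennreal (r x) \<partial>M) \<le> 1" and int: "integrable M (\<lambda>x. ln (r x))"
  shows "(\<integral>x. ln (r x) \<partial>M) \<le> 0"
proof -
  interpret prob_space M by fact
  have r: "integrable M r"
    using le pos by (intro integrableI_nonneg) (auto intro: less_imp_le simp: order.strict_trans1)
  have "ennreal (\<integral>x. r x \<partial>M) \<le> ennreal 1"
    using le nn_integral_eq_integral[OF r] pos by (simp add: AE_I2 less_imp_le)
  then have "(\<integral>x. r x \<partial>M) \<le> 1" by simp
  moreover have "(\<integral>x. ln (r x) \<partial>M) \<le> (\<integral>x. r x - 1 \<partial>M)"
    using int r pos by (intro integral_mono) (auto intro: ln_le_minus_one)
  ultimately show ?thesis using r by (simp add: prob_space)
qed

text \<open>A finite second moment, rather than bounded support, is the requirement on the input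
  because it is inherited by the output law, which can thus be fed into a further channel
  (\<open>out_law_channel\<close>).\<close>

locale gaussian_channel = prob_space Q for Q :: "(nat \<Rightarrow> real) measure" +
  fixes n :: nat and v :: real
  assumes sets_eq [measurable_cong]: "sets Q = sets (euc n)"
    and v_pos: "0 < v"
    and integrable_sqnorm: "integrable Q (\<lambda>x. sqdist n (\<lambda>_. 0) x)"
begin

lemma integrable_gauss_kernel: "integrable Q (\<lambda>x. gauss_kernel n v x y)"
  by (rule integrable_const_bound[where B="exp (- (real n / 2 * ln (2 * pi * v)))"])
     (use v_pos gauss_kernel_le gauss_kernel_pos in \<open>auto simp: abs_of_pos\<close>)

lemma out_density_nonneg: "0 \<le> out_density n v Q y"
  unfolding out_density_def using gauss_kernel_pos[OF v_pos] by (intro Bochner_Integration.integral_nonneg) (simp add: less_imp_le)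

lemma ennreal_out_density: "ennreal (out_density n v Q y) = (\<integral>\<^sup>+x. ennreal (gauss_kernel n v x y) \<partial>Q)"
  unfolding out_density_def using gauss_kernel_pos[OF v_pos]
  by (subst nn_integral_eq_integral[OF integrable_gauss_kernel]) (simp_all add: less_imp_le)

lemma out_density_measurable [measurable]: "out_density n v Q \<in> borel_measurable (euc n)"
  unfolding out_density_def[abs_def] by measurable

lemma out_density_le: "out_density n v Q y \<le> exp (- (real n / 2 * ln (2 * pi * v)))"
  using integral_mono[OF integrable_gauss_kernel integrable_const gauss_kernel_le[OF v_pos]]
  by (simp add: out_density_def prob_space)

lemma integrable_sqdist: "integrable Q (\<lambda>x. sqdist n x y)"
proof (rule Bochner_Integration.integrable_bound)
  show "integrable Q (\<lambda>x. 2 * sqdist n (\<lambda>_. 0) x + 2 * sqdist n (\<lambda>_. 0) y)"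
    using integrable_sqnorm by simp
qed (auto intro!: AE_I2 sqdist_le simp: sqdist_nonneg)

text \<open>Jensen's inequality for \<open>exp\<close>, via the tangent at the mean.\<close>

lemma out_density_ge:
  "exp (- (real n / 2 * ln (2 * pi * v)) - (second_moment n Q + sqdist n (\<lambda>_. 0) y) / v) \<le> out_density n v Q y"
proof -
  define g where "g x = - (real n / 2 * ln (2 * pi * v)) - sqdist n x y / (2 * v)" for x
  define e where "e = (\<integral>x. g x \<partial>Q)"
  have g: "integrable Q g"
    unfolding g_def[abs_def] using integrable_sqdist by simp
  have "(\<integral>x. exp e * (1 + (g x - e)) \<partial>Q) \<le> (\<integral>x. gauss_kernel n v x y \<partial>Q)"
  proof (rule integral_mono[OF _ integrable_gauss_kernel])
    fix x
    have "exp e * (1 + (g x - e)) \<le> exp e * exp (g x - e)"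
      by (intro mult_left_mono exp_ge_add_one_self) simp
    then show "exp e * (1 + (g x - e)) \<le> gauss_kernel n v x y"
      using v_pos by (simp add: exp_add[symmetric] gauss_kernel_eq g_def)
  qed (use g in simp)
  then have *: "exp e \<le> out_density n v Q y"
    using g by (simp add: out_density_def prob_space e_def)
  have "(\<integral>x. sqdist n x y \<partial>Q) \<le> (\<integral>x. 2 * sqdist n (\<lambda>_. 0) x + 2 * sqdist n (\<lambda>_. 0) y \<partial>Q)"
    using integrable_sqdist integrable_sqnorm by (intro integral_mono sqdist_le) auto
  then have "(\<integral>x. sqdist n x y \<partial>Q) / (2 * v) \<le> (second_moment n Q + sqdist n (\<lambda>_. 0) y) / v"
    using integrable_sqnorm v_pos by (simp add: second_moment_def prob_space field_simps)
  then have "- (real n / 2 * ln (2 * pi * v)) - (second_moment n Q + sqdist n (\<lambda>_. 0) y) / v \<le> e"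
    unfolding e_def g_def using integrable_sqdist by (simp add: prob_space)
  then show ?thesis
    using * by (meson exp_le_cancel_iff order_trans)
qed

lemma out_density_pos: "0 < out_density n v Q y"
  using out_density_ge by (rule less_le_trans[OF exp_gt_zero])

text \<open>Quadratic growth of the log-density makes it integrable, since the output has a finite
  second moment. The upper side is the peak of the kernel, the lower side is Jensen's bound
  \<open>out_density_ge\<close>.\<close>

lemma abs_ln_out_density:
  "\<bar>ln (out_density n v Q y)\<bar> \<le> \<bar>real n / 2 * ln (2 * pi * v)\<bar> + (second_moment n Q + sqdist n (\<lambda>_. 0) y) / v"
proof -
  have "0 \<le> second_moment n Q"
    unfolding second_moment_def by (intro Bochner_Integration.integral_nonneg sqdist_nonneg)
  then have "0 \<le> (second_moment n Q + sqdist n (\<lambda>_. 0) y) / v"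
    using v_pos sqdist_nonneg by (intro divide_nonneg_pos add_nonneg_nonneg)
  moreover have "ln (out_density n v Q y) \<le> - (real n / 2 * ln (2 * pi * v))"
    using out_density_le out_density_pos by (metis ln_le_cancel_iff exp_gt_zero ln_exp)
  moreover have "- (real n / 2 * ln (2 * pi * v)) - (second_moment n Q + sqdist n (\<lambda>_. 0) y) / v \<le> ln (out_density n v Q y)"
    using out_density_ge[of y] out_density_pos[of y] by (simp add: ln_ge_iff)
  ultimately show ?thesis by linarith
qed

section \<open>Joint law of input and output, and its marginals\<close>

sublocale L: sigma_finite_measure "euc n"
  by (rule sigma_finite_euc)

sublocale QL: pair_sigma_finite Q "euc n" ..

lemma sets_joint_law [measurable_cong]: "sets (joint_law n v Q) = sets (Q \<Otimes>\<^sub>M euc n)"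
  by (simp add: joint_law_def)

lemma sets_out_law [measurable_cong]: "sets (out_law n v Q) = sets (euc n)"
  by (simp add: out_law_def)

lemma nn_integral_joint_law:
  assumes [measurable]: "f \<in> borel_measurable (Q \<Otimes>\<^sub>M euc n)"
  shows "(\<integral>\<^sup>+w. f w \<partial>joint_law n v Q) = (\<integral>\<^sup>+x. \<integral>\<^sup>+y. f (x, y) * ennreal (gauss_kernel n v x y) \<partial>euc n \<partial>Q)"
  unfolding joint_law_def
  by (subst nn_integral_density, measurable)
     (simp add: L.nn_integral_fst[symmetric] mult.commute split_beta')

lemma prob_space_joint_law: "prob_space (joint_law n v Q)"
proof
  show "emeasure (joint_law n v Q) (space (joint_law n v Q)) = 1"
    using nn_integral_joint_law[of "\<lambda>_. 1"] v_pos
    by (simp add: nn_integral_gauss_kernel emeasure_space_1)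
qed

lemma distr_joint_law_fst: "distr (joint_law n v Q) Q fst = Q"
proof (rule measure_eqI)
  fix A assume "A \<in> sets (distr (joint_law n v Q) Q fst)"
  then have A [measurable]: "A \<in> sets Q" by simp
  have "emeasure (distr (joint_law n v Q) Q fst) A = (\<integral>\<^sup>+x. indicator A x \<partial>distr (joint_law n v Q) Q fst)"
    by simp
  also have "\<dots> = (\<integral>\<^sup>+w. indicator A (fst w) \<partial>joint_law n v Q)"
    by (subst nn_integral_distr) auto
  also have "\<dots> = emeasure Q A"
    using v_pos by (subst nn_integral_joint_law) (auto simp: nn_integral_cmult nn_integral_gauss_kernel)
  finally show "emeasure (distr (joint_law n v Q) Q fst) A = emeasure Q A" .
qed simp

lemma distr_joint_law_snd: "distr (joint_law n v Q) (euc n) snd = out_law n v Q"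
proof (rule measure_eqI)
  fix A assume "A \<in> sets (distr (joint_law n v Q) (euc n) snd)"
  then have A [measurable]: "A \<in> sets (euc n)" by simp
  have "emeasure (distr (joint_law n v Q) (euc n) snd) A = (\<integral>\<^sup>+x. indicator A x \<partial>distr (joint_law n v Q) (euc n) snd)"
    by simp
  also have "\<dots> = (\<integral>\<^sup>+w. indicator A (snd w) \<partial>joint_law n v Q)"
    by (subst nn_integral_distr) auto
  also have "\<dots> = (\<integral>\<^sup>+x. \<integral>\<^sup>+y. indicator A y * ennreal (gauss_kernel n v x y) \<partial>euc n \<partial>Q)"
    by (subst nn_integral_joint_law) auto
  also have "\<dots> = (\<integral>\<^sup>+y. \<integral>\<^sup>+x. indicator A y * ennreal (gauss_kernel n v x y) \<partial>Q \<partial>euc n)"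
    by (subst QL.Fubini') auto
  also have "\<dots> = emeasure (out_law n v Q) A"
    unfolding out_law_def by (subst emeasure_density) (auto simp: nn_integral_cmult ennreal_out_density mult.commute)
  finally show "emeasure (distr (joint_law n v Q) (euc n) snd) A = emeasure (out_law n v Q) A" .
qed (simp add: out_law_def)

lemma prob_space_out_law: "prob_space (out_law n v Q)"
  unfolding distr_joint_law_snd[symmetric]
  by (rule prob_space.prob_space_distr[OF prob_space_joint_law]) measurable

text \<open>Condition on the input: for fixed \<open>x\<close> the translated noise has the kernel
  as its density, by \<open>distr_gauss_vec_translate\<close>.\<close>

lemma joint_law_eq_distr:
  "distr (Q \<Otimes>\<^sub>M gauss_vec n v) (Q \<Otimes>\<^sub>M euc n) (\<lambda>w. (fst w, restrict (\<lambda>i. fst w i + snd w i) {..<n})) = joint_law n v Q"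
  (is "distr ?M ?N ?T = _")
proof (rule measure_eqI)
  have G [measurable_cong]: "sets (gauss_vec n v) = sets (euc n)"
    using v_pos by (simp add: gauss_vec_eq_density)
  interpret G: prob_space "gauss_vec n v"
    using v_pos by (intro prob_spaceI) (simp add: gauss_vec_eq_density nn_integral_gauss_kernel emeasure_density)
  have R [measurable]: "(\<lambda>w. restrict (\<lambda>i. fst w i + snd w i) {..<n}) \<in> ?M \<rightarrow>\<^sub>M euc n"
    by (subst euc_def) (rule measurable_restrict, simp)
  have S [measurable]: "(\<lambda>z. restrict (\<lambda>i. x i + z i) {..<n}) \<in> gauss_vec n v \<rightarrow>\<^sub>M euc n" for x
    by (subst euc_def) (rule measurable_restrict, simp)
  fix A assume "A \<in> sets (distr ?M ?N ?T)"
  then have A [measurable]: "A \<in> sets ?N" by simp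
  have "emeasure (distr ?M ?N ?T) A = (\<integral>\<^sup>+u. indicator A u \<partial>distr ?M ?N ?T)"
    by simp
  also have "\<dots> = (\<integral>\<^sup>+w. indicator A (?T w) \<partial>?M)"
    by (subst nn_integral_distr) auto
  also have "\<dots> = (\<integral>\<^sup>+x. \<integral>\<^sup>+z. indicator A (x, restrict (\<lambda>i. x i + z i) {..<n}) \<partial>gauss_vec n v \<partial>Q)"
    by (subst G.nn_integral_fst[symmetric]) auto
  also have "\<dots> = (\<integral>\<^sup>+x. \<integral>\<^sup>+y. indicator A (x, y) \<partial>distr (gauss_vec n v) (euc n) (\<lambda>z. restrict (\<lambda>i. x i + z i) {..<n}) \<partial>Q)"
    by (intro nn_integral_cong, subst nn_integral_distr) auto
  also have "\<dots> = (\<integral>\<^sup>+x. \<integral>\<^sup>+y. indicator A (x, y) * ennreal (gauss_kernel n v x y) \<partial>euc n \<partial>Q)"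
    unfolding distr_gauss_vec_translate[OF v_pos]
    by (intro nn_integral_cong, subst nn_integral_density) (auto simp: mult.commute)
  also have "\<dots> = emeasure (joint_law n v Q) A"
    by (subst nn_integral_joint_law[symmetric]) (auto simp: joint_law_def)
  finally show "emeasure (distr ?M ?N ?T) A = emeasure (joint_law n v Q) A" .
qed (simp add: joint_law_def)

section \<open>Expectations and second moments under the joint and output laws\<close>

lemma
  shows integrable_out_law_iff: "f \<in> borel_measurable (euc n) \<Longrightarrow>
      integrable (out_law n v Q) f \<longleftrightarrow> integrable (joint_law n v Q) (\<lambda>w. f (snd w) :: real)"
    and integral_out_law: "f \<in> borel_measurable (euc n) \<Longrightarrow>
      (\<integral>y. f y \<partial>out_law n v Q) = (\<integral>w. f (snd w) \<partial>joint_law n v Q)"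
  unfolding distr_joint_law_snd[symmetric] by (simp_all add: integrable_distr_eq integral_distr)

lemma
  shows integrable_fst_iff: "f \<in> borel_measurable (euc n) \<Longrightarrow>
      integrable (joint_law n v Q) (\<lambda>w. f (fst w) :: real) \<longleftrightarrow> integrable Q f"
    and integral_fst: "f \<in> borel_measurable (euc n) \<Longrightarrow>
      (\<integral>w. f (fst w) \<partial>joint_law n v Q) = (\<integral>x. f x \<partial>Q)"
  using distr_joint_law_fst integrable_distr_eq[of fst "joint_law n v Q" Q f] integral_distr[of fst "joint_law n v Q" Q f]
  by simp_all

text \<open>Mean squared error of the estimate \<open>a Y\<close> of the input:
  \<open>X - a Y = (1 - a) X - a N\<close>, and the cross term vanishes because the noise is centred
  and independent. Other second moments follow by specialising \<open>a\<close>.\<close>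

lemma has_bochner_integral_joint_sqdist_affine:
  "has_bochner_integral (joint_law n v Q) (\<lambda>w. sqdist n (\<lambda>i. a * snd w i) (fst w)) (a\<^sup>2 * real n * v + (1 - a)\<^sup>2 * second_moment n Q)"
proof (rule has_bochner_integral_nn_integral)
  have nn: "(\<integral>\<^sup>+w. ennreal (sqdist n (\<lambda>i. a * snd w i) (fst w)) \<partial>joint_law n v Q)
     = (\<integral>\<^sup>+x. \<integral>\<^sup>+y. ennreal (sqdist n (\<lambda>i. a * y i) x) * ennreal (gauss_kernel n v x y) \<partial>euc n \<partial>Q)"
    by (subst nn_integral_joint_law) auto
  also have "\<dots> = (\<integral>\<^sup>+x. ennreal (a\<^sup>2 * real n * v + (1 - a)\<^sup>2 * sqdist n (\<lambda>_. 0) x) \<partial>Q)"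
  proof (intro nn_integral_cong)
    fix x
    show "(\<integral>\<^sup>+y. ennreal (sqdist n (\<lambda>i. a * y i) x) * ennreal (gauss_kernel n v x y) \<partial>euc n)
      = ennreal (a\<^sup>2 * real n * v + (1 - a)\<^sup>2 * sqdist n (\<lambda>_. 0) x)"
    proof (cases "a = 0")
      case True
      then show ?thesis using v_pos by (simp add: nn_integral_cmult nn_integral_gauss_kernel)
    next
      case False
      \<comment> \<open>Pulling out the square of \<open>a\<close> leaves a squared distance from
        the integration variable to the fixed centre \<open>x / a\<close>, the form covered by
        \<open>nn_integral_gauss_kernel_sqdist\<close>. The division is why \<open>a = 0\<close> is
        treated apart.\<close>
      have "sqdist n (\<lambda>i. a * y i) x = a\<^sup>2 * sqdist n (\<lambda>i. x i / a) y" for y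
        unfolding sqdist_def sum_distrib_left using False
        by (intro sum.cong) (auto simp: power2_eq_square field_simps)
      then have "(\<integral>\<^sup>+y. ennreal (sqdist n (\<lambda>i. a * y i) x) * ennreal (gauss_kernel n v x y) \<partial>euc n)
        = (\<integral>\<^sup>+y. ennreal (a\<^sup>2) * (ennreal (sqdist n (\<lambda>i. x i / a) y) * ennreal (gauss_kernel n v x y)) \<partial>euc n)"
        by (simp add: ennreal_mult sqdist_nonneg mult.assoc)
      also have "\<dots> = ennreal (a\<^sup>2) * ennreal (real n * v + sqdist n (\<lambda>i. x i / a) x)"
        using v_pos by (subst nn_integral_cmult) (auto simp: nn_integral_gauss_kernel_sqdist)
      also have "\<dots> = ennreal (a\<^sup>2 * (real n * v + sqdist n (\<lambda>i. x i / a) x))"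
        using v_pos by (intro ennreal_mult[symmetric]) (auto simp: sqdist_nonneg)
      also have "a\<^sup>2 * (real n * v + sqdist n (\<lambda>i. x i / a) x) = a\<^sup>2 * real n * v + (1 - a)\<^sup>2 * sqdist n (\<lambda>_. 0) x"
      proof -
        have "a\<^sup>2 * sqdist n (\<lambda>i. x i / a) x = (1 - a)\<^sup>2 * sqdist n (\<lambda>_. 0) x"
          unfolding sqdist_def sum_distrib_left using False
          by (intro sum.cong) (auto simp: power2_eq_square field_simps)
        then show ?thesis by (simp add: algebra_simps)
      qed
      finally show ?thesis .
    qed
  qed
  also have "\<dots> = ennreal (\<integral>x. a\<^sup>2 * real n * v + (1 - a)\<^sup>2 * sqdist n (\<lambda>_. 0) x \<partial>Q)"
    using v_pos integrable_sqnorm by (intro nn_integral_eq_integral) (auto simp: sqdist_nonneg)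
  also have "(\<integral>x. a\<^sup>2 * real n * v + (1 - a)\<^sup>2 * sqdist n (\<lambda>_. 0) x \<partial>Q) = a\<^sup>2 * real n * v + (1 - a)\<^sup>2 * second_moment n Q"
    using integrable_sqnorm by (simp add: second_moment_def prob_space)
  finally show "(\<integral>\<^sup>+w. ennreal (sqdist n (\<lambda>i. a * snd w i) (fst w)) \<partial>joint_law n v Q)
     = ennreal (a\<^sup>2 * real n * v + (1 - a)\<^sup>2 * second_moment n Q)" .
  show "0 \<le> a\<^sup>2 * real n * v + (1 - a)\<^sup>2 * second_moment n Q"
    using v_pos unfolding second_moment_def by (intro add_nonneg_nonneg mult_nonneg_nonneg Bochner_Integration.integral_nonneg sqdist_nonneg) auto
qed (auto simp: sqdist_nonneg)

lemma has_bochner_integral_joint_sqdist: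
  "has_bochner_integral (joint_law n v Q) (\<lambda>w. sqdist n (fst w) (snd w)) (real n * v)"
  using has_bochner_integral_joint_sqdist_affine[of 1] by (simp add: sqdist_commute)

lemma has_bochner_integral_out_sqnorm:
  "has_bochner_integral (out_law n v Q) (\<lambda>y. sqdist n (\<lambda>_. 0) y) (second_moment n Q + real n * v)"
proof -
  \<comment> \<open>Parallelogram identity \<open>|x + y|^2 + |x - y|^2 - 2 |x|^2 = 2 |y|^2\<close>:
    the estimates with \<open>a = -1\<close>, \<open>1\<close> and \<open>0\<close> combine to the
    output energy.\<close>
  have *: "has_bochner_integral (joint_law n v Q) (\<lambda>w. sqdist n (\<lambda>i. - 1 * snd w i) (fst w)
      + sqdist n (\<lambda>i. 1 * snd w i) (fst w) - 2 * sqdist n (\<lambda>i. 0 * snd w i) (fst w))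
    (((- 1)\<^sup>2 * real n * v + (1 - - 1)\<^sup>2 * second_moment n Q) + (1\<^sup>2 * real n * v + (1 - 1)\<^sup>2 * second_moment n Q)
      - 2 * (0\<^sup>2 * real n * v + (1 - 0)\<^sup>2 * second_moment n Q))"
    by (intro has_bochner_integral_add has_bochner_integral_diff has_bochner_integral_mult_right has_bochner_integral_joint_sqdist_affine)
  have "sqdist n (\<lambda>i. - 1 * y i) x + sqdist n (\<lambda>i. 1 * y i) x - 2 * sqdist n (\<lambda>i. 0 * y i) x = 2 * sqdist n (\<lambda>_. 0) y" for x y
    unfolding sqdist_def sum_distrib_left sum.distrib[symmetric] sum_subtractf[symmetric]
    by (intro sum.cong) (auto simp: power2_eq_square algebra_simps)
  then have "has_bochner_integral (joint_law n v Q) (\<lambda>w. 2 * sqdist n (\<lambda>_. 0) (snd w)) (2 * (second_moment n Q + real n * v))"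
    using * by (simp add: algebra_simps)
  then have "has_bochner_integral (joint_law n v Q) (\<lambda>w. sqdist n (\<lambda>_. 0) (snd w)) (second_moment n Q + real n * v)"
    by (simp add: has_bochner_integral_iff)
  then show ?thesis
    by (simp add: has_bochner_integral_iff integrable_out_law_iff integral_out_law)
qed

lemma integrable_ln_out_density: "integrable (out_law n v Q) (\<lambda>y. ln (out_density n v Q y))"
proof (rule Bochner_Integration.integrable_bound)
  interpret O: prob_space "out_law n v Q" by (rule prob_space_out_law)
  show "integrable (out_law n v Q) (\<lambda>y. \<bar>real n / 2 * ln (2 * pi * v)\<bar> + (second_moment n Q + sqdist n (\<lambda>_. 0) y) / v)"
    using has_bochner_integral_out_sqnorm by (simp add: has_bochner_integral_iff)
  show "AE y in out_law n v Q. norm (ln (out_density n v Q y))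
      \<le> norm (\<bar>real n / 2 * ln (2 * pi * v)\<bar> + (second_moment n Q + sqdist n (\<lambda>_. 0) y) / v)"
    unfolding real_norm_def by (intro AE_I2 order_trans[OF abs_ln_out_density abs_ge_self])
qed measurable

section \<open>Adding the noise in two stages\<close>

lemma out_law_channel: "0 < d \<Longrightarrow> gaussian_channel (out_law n v Q) n d"
  using has_bochner_integral_out_sqnorm
  by (intro gaussian_channel.intro gaussian_channel_axioms.intro prob_space_out_law sets_out_law)
     (auto simp: has_bochner_integral_iff)

lemma second_moment_out_law: "second_moment n (out_law n v Q) = second_moment n Q + real n * v"
  unfolding second_moment_def[of n "out_law n v Q"] using has_bochner_integral_out_sqnorm
  by (simp add: has_bochner_integral_iff)

lemma with_noise: "0 < w \<Longrightarrow> gaussian_channel Q n w"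
  by unfold_locales (use sets_eq integrable_sqnorm in auto)

text \<open>Chapman-Kolmogorov: exchange the two integrals and convolve the kernels. It exhibits the
  noisier output as a degraded version of the less noisy one.\<close>

lemma out_density_out_law:
  assumes "0 < d"
  shows "out_density n d (out_law n v Q) y = out_density n (v + d) Q y"
proof -
  interpret D: gaussian_channel "out_law n v Q" n d by (rule out_law_channel) fact
  interpret S: gaussian_channel Q n "v + d" using assms v_pos by (intro with_noise) simp
  have "ennreal (out_density n d (out_law n v Q) y) = (\<integral>\<^sup>+x. ennreal (gauss_kernel n d x y) \<partial>out_law n v Q)"
    by (rule D.ennreal_out_density)
  also have "\<dots> = (\<integral>\<^sup>+x. (\<integral>\<^sup>+u. ennreal (gauss_kernel n v u x) \<partial>Q) * ennreal (gauss_kernel n d x y) \<partial>euc n)"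
    unfolding out_law_def by (subst nn_integral_density) (auto simp: ennreal_out_density)
  also have "\<dots> = (\<integral>\<^sup>+x. \<integral>\<^sup>+u. ennreal (gauss_kernel n v u x) * ennreal (gauss_kernel n d x y) \<partial>Q \<partial>euc n)"
    by (intro nn_integral_cong nn_integral_multc[symmetric]) auto
  also have "\<dots> = (\<integral>\<^sup>+u. \<integral>\<^sup>+x. ennreal (gauss_kernel n v u x) * ennreal (gauss_kernel n d x y) \<partial>euc n \<partial>Q)"
    by (subst QL.Fubini') auto
  also have "\<dots> = ennreal (out_density n (v + d) Q y)"
    using v_pos assms by (simp add: nn_integral_gauss_kernel_conv S.ennreal_out_density)
  finally show ?thesis
    by (simp add: D.out_density_nonneg S.out_density_nonneg)
qed

lemma out_law_out_law: "0 < d \<Longrightarrow> out_law n d (out_law n v Q) = out_law n (v + d) Q"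
  unfolding out_law_def[of n d] out_law_def[of n "v + d"] by (simp add: out_density_out_law)

section \<open>Bounds on the output entropy\<close>

lemma integrable_ln_gauss_kernel_out: "0 < s \<Longrightarrow> integrable (out_law n v Q) (\<lambda>y. ln (gauss_kernel n s (\<lambda>_. 0) y))"
  and integral_ln_gauss_kernel_out: "0 < s \<Longrightarrow> (\<integral>y. ln (gauss_kernel n s (\<lambda>_. 0) y) \<partial>out_law n v Q)
    = - (real n / 2 * ln (2 * pi * s)) - (second_moment n Q + real n * v) / (2 * s)"
proof -
  interpret O: prob_space "out_law n v Q" by (rule prob_space_out_law)
  assume "0 < s"
  then show "integrable (out_law n v Q) (\<lambda>y. ln (gauss_kernel n s (\<lambda>_. 0) y))"
    "(\<integral>y. ln (gauss_kernel n s (\<lambda>_. 0) y) \<partial>out_law n v Q)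
      = - (real n / 2 * ln (2 * pi * s)) - (second_moment n Q + real n * v) / (2 * s)"
    using has_bochner_integral_out_sqnorm by (simp_all add: ln_gauss_kernel has_bochner_integral_iff O.prob_space)
qed

text \<open>By Gibbs' inequality the entropy is at most the cross-entropy against a centred
  Gaussian. Its variance \<open>s\<close> stays free, to be matched later to the power
  bound.\<close>

lemma out_entropy_le:
  assumes "0 < s"
  shows "out_entropy n v Q \<le> real n / 2 * ln (2 * pi * s) + (second_moment n Q + real n * v) / (2 * s)"
proof -
  let ?f = "out_density n v Q" and ?g = "gauss_kernel n s (\<lambda>_. 0)"
  have ln: "ln (?g y / ?f y) = ln (?g y) - ln (?f y)" for y
    using gauss_kernel_pos[OF assms] out_density_pos by (simp add: ln_div less_imp_neq[symmetric])
  have "(\<integral>y. ln (?g y / ?f y) \<partial>out_law n v Q) \<le> 0"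
  proof (rule integral_ln_nonpos[OF prob_space_out_law])
    show "0 < ?g y / ?f y" for y
      using gauss_kernel_pos[OF assms] out_density_pos by simp
    have "(\<integral>\<^sup>+y. ennreal (?g y / ?f y) \<partial>out_law n v Q) = (\<integral>\<^sup>+y. ennreal (?f y) * ennreal (?g y / ?f y) \<partial>euc n)"
      unfolding out_law_def by (subst nn_integral_density) auto
    also have "\<dots> = (\<integral>\<^sup>+y. ennreal (?g y) \<partial>euc n)"
      using gauss_kernel_pos[OF assms] out_density_pos
      by (intro nn_integral_cong) (simp add: ennreal_mult'[symmetric] less_imp_le less_imp_neq[symmetric])
    finally show "(\<integral>\<^sup>+y. ennreal (?g y / ?f y) \<partial>out_law n v Q) \<le> 1"
      using assms by (simp add: nn_integral_gauss_kernel)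
    show "integrable (out_law n v Q) (\<lambda>y. ln (?g y / ?f y))"
      unfolding ln using assms integrable_ln_out_density integrable_ln_gauss_kernel_out by auto
  qed measurable
  then show ?thesis
    unfolding ln using assms integrable_ln_out_density integrable_ln_gauss_kernel_out integral_ln_gauss_kernel_out
    by (simp add: out_entropy_def)
qed

text \<open>Domination of the density by \<open>K\<close> times a Gaussian bounds
  \<open>- ln\<close> of it from below pointwise. Thus a truncated input loses only
  \<open>ln K\<close>, and its exact output density is never computed.\<close>

lemma out_entropy_ge:
  assumes "0 < s" "0 < K" and le: "\<And>y. out_density n v Q y \<le> K * gauss_kernel n s (\<lambda>_. 0) y"
  shows "real n / 2 * ln (2 * pi * s) + (second_moment n Q + real n * v) / (2 * s) - ln K \<le> out_entropy n v Q"
proof -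
  interpret O: prob_space "out_law n v Q" by (rule prob_space_out_law)
  have "(\<integral>y. ln (out_density n v Q y) \<partial>out_law n v Q) \<le> (\<integral>y. ln K + ln (gauss_kernel n s (\<lambda>_. 0) y) \<partial>out_law n v Q)"
  proof (rule integral_mono)
    fix y
    show "ln (out_density n v Q y) \<le> ln K + ln (gauss_kernel n s (\<lambda>_. 0) y)"
      using ln_mono[OF le[of y] out_density_pos] assms(2) gauss_kernel_pos[OF assms(1), of n "\<lambda>_. 0" y]
      by (simp add: ln_mult_pos)
  qed (use assms integrable_ln_out_density integrable_ln_gauss_kernel_out in auto)
  then show ?thesis
    using assms integrable_ln_gauss_kernel_out integral_ln_gauss_kernel_out
    by (simp add: out_entropy_def O.prob_space)
qed

text \<open>Nonnegativity of the divergence of the law of \<open>(Y\<^sub>1, Y\<^sub>2)\<close> from the law under which \<open>Y\<^sub>1\<close> given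
  \<open>Y\<^sub>2\<close> is Gaussian around the linear estimate \<open>a Y\<^sub>2\<close>, as it would be for a Gaussian input of variance \<open>S\<close>.\<close>

lemma out_entropy_increment:
  assumes "0 < d" "0 \<le> S" and m: "second_moment n Q \<le> real n * S"
  shows "real n / 2 * ln ((S + v + d) / (S + v)) \<le> out_entropy n (v + d) Q - out_entropy n v Q"
proof -
  \<comment> \<open>For a Gaussian \<open>Y1\<close> of variance \<open>S + v\<close> per coordinate
    observed through further noise of variance \<open>d\<close>, \<open>a\<close> is the
    least-squares coefficient and \<open>w\<close> the resulting error variance.\<close>
  define a where "a = (S + v) / (S + v + d)"
  define w where "w = (S + v) * d / (S + v + d)"
  have w: "0 < w" and Sv: "0 < S + v" using assms v_pos by (auto simp: w_def)
  interpret C: gaussian_channel "out_law n v Q" n d using assms by (intro out_law_channel)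
  interpret S2: gaussian_channel Q n "v + d" using assms v_pos by (intro with_noise) simp
  interpret O2: prob_space "out_law n (v + d) Q" by (rule S2.prob_space_out_law)
  interpret LL: pair_sigma_finite "euc n" "euc n" ..
  let ?N = "joint_law n d (out_law n v Q)"
  interpret N: prob_space ?N by (rule C.prob_space_joint_law)
  let ?f1 = "out_density n v Q" and ?f2 = "out_density n (v + d) Q"
  let ?q = "\<lambda>x y. gauss_kernel n w (\<lambda>i. a * y i) x"
  \<comment> \<open>Likelihood ratio on pairs \<open>(Y1, Y2)\<close>: the numerator draws
    \<open>Y2\<close> first and then \<open>Y1\<close> around \<open>a Y2\<close>, the denominator
    is the true joint density.\<close>
  define r where "r z = ?f2 (snd z) * ?q (fst z) (snd z) / (?f1 (fst z) * gauss_kernel n d (fst z) (snd z))" for z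
  note pos = out_density_pos S2.out_density_pos gauss_kernel_pos[OF w] gauss_kernel_pos[OF \<open>0 < d\<close>]
  have [measurable]: "r \<in> borel_measurable (out_law n v Q \<Otimes>\<^sub>M euc n)"
    unfolding r_def[abs_def] by measurable
  have I1: "integrable ?N (\<lambda>z. ln (?f1 (fst z)))" "(\<integral>z. ln (?f1 (fst z)) \<partial>?N) = - out_entropy n v Q"
    using integrable_ln_out_density unfolding out_entropy_def
    by (subst C.integrable_fst_iff, simp_all) (subst C.integral_fst, simp_all)
  have I2: "integrable ?N (\<lambda>z. ln (?f2 (snd z)))" "(\<integral>z. ln (?f2 (snd z)) \<partial>?N) = - out_entropy n (v + d) Q"
    using S2.integrable_ln_out_density assms unfolding out_entropy_def out_law_out_law[OF \<open>0 < d\<close>, symmetric]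
    by (subst C.integrable_out_law_iff[symmetric], simp_all) (subst C.integral_out_law, simp_all)
  have I3: "integrable ?N (\<lambda>z. sqdist n (\<lambda>i. a * snd z i) (fst z))"
    "(\<integral>z. sqdist n (\<lambda>i. a * snd z i) (fst z) \<partial>?N) = a\<^sup>2 * real n * d + (1 - a)\<^sup>2 * (second_moment n Q + real n * v)"
    using C.has_bochner_integral_joint_sqdist_affine[of a] by (simp_all add: has_bochner_integral_iff second_moment_out_law)
  have I4: "integrable ?N (\<lambda>z. sqdist n (fst z) (snd z))" "(\<integral>z. sqdist n (fst z) (snd z) \<partial>?N) = real n * d"
    using C.has_bochner_integral_joint_sqdist by (simp_all add: has_bochner_integral_iff)
  have ln_r: "ln (r z) = ln (?f2 (snd z)) + (- (real n / 2 * ln (2 * pi * w)) - sqdist n (\<lambda>i. a * snd z i) (fst z) / (2 * w))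
      - ln (?f1 (fst z)) - (- (real n / 2 * ln (2 * pi * d)) - sqdist n (fst z) (snd z) / (2 * d))" for z
    unfolding ln_gauss_kernel[OF w, symmetric] ln_gauss_kernel[OF \<open>0 < d\<close>, symmetric] r_def
    using pos by (simp add: ln_div ln_mult less_imp_neq[symmetric])
  have "(\<integral>z. ln (r z) \<partial>?N) \<le> 0"
  proof (rule integral_ln_nonpos[OF N.prob_space_axioms])
    show "r \<in> borel_measurable ?N" by measurable
    show "0 < r z" for z unfolding r_def using pos by simp
    show "integrable ?N (\<lambda>z. ln (r z))" unfolding ln_r using I1 I2 I3 I4 by simp
    have "(\<integral>\<^sup>+z. ennreal (r z) \<partial>?N) = (\<integral>\<^sup>+x. \<integral>\<^sup>+y. ennreal (r (x, y)) * ennreal (gauss_kernel n d x y) \<partial>euc n \<partial>out_law n v Q)"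
      by (subst C.nn_integral_joint_law) auto
    also have "\<dots> = (\<integral>\<^sup>+x. ennreal (?f1 x) * (\<integral>\<^sup>+y. ennreal (r (x, y)) * ennreal (gauss_kernel n d x y) \<partial>euc n) \<partial>euc n)"
      unfolding out_law_def by (subst nn_integral_density) auto
    \<comment> \<open>The true density cancels, leaving the reference density. Integrating over
      \<open>x\<close> first then removes the factor \<open>?q\<close>, whose mass is
      \<open>1\<close> for each \<open>y\<close>.\<close>
    also have "\<dots> = (\<integral>\<^sup>+x. \<integral>\<^sup>+y. ennreal (?f2 y) * ennreal (?q x y) \<partial>euc n \<partial>euc n)"
    proof (rule nn_integral_cong)
      fix x
      have [measurable]: "(\<lambda>y. r (x, y)) \<in> borel_measurable (euc n)"
        unfolding r_def by simp
      have "ennreal (?f1 x) * (ennreal (r (x, y)) * ennreal (gauss_kernel n d x y)) = ennreal (?f2 y) * ennreal (?q x y)" for y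
        using pos by (simp add: r_def ennreal_mult'[symmetric] less_imp_le less_imp_neq[symmetric])
      then show "ennreal (?f1 x) * (\<integral>\<^sup>+y. ennreal (r (x, y)) * ennreal (gauss_kernel n d x y) \<partial>euc n)
         = (\<integral>\<^sup>+y. ennreal (?f2 y) * ennreal (?q x y) \<partial>euc n)"
        by (subst nn_integral_cmult[symmetric]) auto
    qed
    also have "\<dots> = (\<integral>\<^sup>+y. \<integral>\<^sup>+x. ennreal (?f2 y) * ennreal (?q x y) \<partial>euc n \<partial>euc n)"
      by (subst LL.Fubini') auto
    also have "\<dots> = (\<integral>\<^sup>+y. ennreal (?f2 y) \<partial>euc n)"
      using w by (simp add: nn_integral_cmult nn_integral_gauss_kernel)
    also have "\<dots> = 1"
      using O2.emeasure_space_1 by (simp add: out_law_def emeasure_density)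
    finally show "(\<integral>\<^sup>+z. ennreal (r z) \<partial>?N) \<le> 1" by simp
  qed
  then have *: "- out_entropy n (v + d) Q - real n / 2 * ln (2 * pi * w)
      - (a\<^sup>2 * real n * d + (1 - a)\<^sup>2 * (second_moment n Q + real n * v)) / (2 * w)
      + out_entropy n v Q + real n / 2 * ln (2 * pi * d) + real n / 2 \<le> 0"
    unfolding ln_r using I1 I2 I3 I4 assms by (simp add: N.prob_space)
  \<comment> \<open>At the least-squares coefficient the mean squared error equals \<open>w\<close>,
    so an input of energy exactly \<open>n S\<close> contributes \<open>n / 2\<close>, balancing the
    noise term \<open>n d / (2 d)\<close>.\<close>
  have wa: "a\<^sup>2 * d + (1 - a)\<^sup>2 * (S + v) = w"
  proof -
    define T where "T = S + v"
    have T: "T + d \<noteq> 0" using Sv assms by (simp add: T_def)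
    then have "1 - a = d / (T + d)" by (simp add: a_def T_def[symmetric] field_simps)
    then have "a\<^sup>2 * d + (1 - a)\<^sup>2 * T = (T\<^sup>2 * d + d\<^sup>2 * T) / (T + d)\<^sup>2"
      by (simp add: a_def T_def[symmetric] power_divide add_divide_distrib)
    also have "T\<^sup>2 * d + d\<^sup>2 * T = (T * d) * (T + d)"
      by (simp add: power2_eq_square algebra_simps)
    finally show ?thesis using T by (simp add: w_def T_def[symmetric] power2_eq_square)
  qed
  have "real n * w = a\<^sup>2 * real n * d + (1 - a)\<^sup>2 * (real n * S + real n * v)"
    unfolding wa[symmetric] by (simp add: algebra_simps)
  \<comment> \<open>The error is nondecreasing in the input energy, so the power bound
    \<open>m\<close> reduces to the boundary case.\<close>
  then have "a\<^sup>2 * real n * d + (1 - a)\<^sup>2 * (second_moment n Q + real n * v) \<le> real n * w"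
    using m by (simp add: mult_left_mono)
  then have "(a\<^sup>2 * real n * d + (1 - a)\<^sup>2 * (second_moment n Q + real n * v)) / (2 * w) \<le> real n / 2"
    using w by (simp add: field_simps)
  moreover have "ln (2 * pi * d) - ln (2 * pi * w) = ln ((S + v + d) / (S + v))"
  proof -
    have U: "0 < S + v + d" using Sv assms by simp
    then have "2 * pi * d = (S + v + d) / (S + v) * (2 * pi * w)"
      using Sv by (simp add: w_def)
    then have "ln (2 * pi * d) = ln ((S + v + d) / (S + v)) + ln (2 * pi * w)"
      using U Sv w by (simp only:) (rule ln_mult_pos, simp_all)
    then show ?thesis by simp
  qed
  then have "real n / 2 * ln (2 * pi * d) - real n / 2 * ln (2 * pi * w) = real n / 2 * ln ((S + v + d) / (S + v))"
    by (simp add: right_diff_distrib[symmetric])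
  ultimately show ?thesis using * by linarith
qed

section \<open>Mutual information as a difference of entropies\<close>

lemma chan_MI_eq: "chan_MI n v Q = out_entropy n v Q - real n / 2 * ln (2 * pi * v) - real n / 2"
proof -
  let ?G = "gauss_vec n v"
  let ?M = "Q \<Otimes>\<^sub>M ?G"
  let ?Y = "\<lambda>w. restrict (\<lambda>i. fst w i + snd w i) {..<n}"
  let ?f = "out_density n v Q"
  have G [measurable_cong]: "sets ?G = sets (euc n)"
    using v_pos by (simp add: gauss_vec_eq_density)
  interpret G: prob_space ?G
    using v_pos by (intro prob_spaceI) (simp add: gauss_vec_eq_density nn_integral_gauss_kernel emeasure_density)
  interpret M: pair_prob_space Q ?G ..
  interpret I: information_space ?M "exp 1"
    by standard simp
  interpret J: prob_space "joint_law n v Q" by (rule prob_space_joint_law)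
  have Y [measurable]: "?Y \<in> ?M \<rightarrow>\<^sub>M euc n"
    by (subst euc_def) (rule measurable_restrict, simp)
  have T: "distr ?M (Q \<Otimes>\<^sub>M euc n) (\<lambda>w. (fst w, ?Y w)) = joint_law n v Q"
    by (rule joint_law_eq_distr)
  have X1: "distr ?M Q fst = Q"
    using distr_joint_law_fst unfolding T[symmetric] by (subst (asm) distr_distr) (simp_all add: comp_def)
  have Y1: "distr ?M (euc n) ?Y = out_law n v Q"
    using distr_joint_law_snd unfolding T[symmetric] by (subst (asm) distr_distr) (simp_all add: comp_def)
  \<comment> \<open>With \<open>Q\<close> itself as reference measure the input has density
    \<open>1\<close>; this also covers inputs without a Lebesgue density, such as point
    masses.\<close>
  have dX: "distributed ?M Q fst (\<lambda>_. 1 :: real)"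
    unfolding distributed_def by (simp add: X1 density_1)
  have dY: "distributed ?M (euc n) ?Y ?f"
    unfolding distributed_def Y1 by (simp add: out_law_def)
  have dXY: "distributed ?M (Q \<Otimes>\<^sub>M euc n) (\<lambda>w. (fst w, ?Y w)) (\<lambda>w. gauss_kernel n v (fst w) (snd w))"
    unfolding distributed_def T by (simp add: joint_law_def split_beta')
  \<comment> \<open>Mutual information sees a target space only through its sigma-algebra, so
    \<open>Q\<close> can replace \<open>euc n\<close> for the input.\<close>
  have "chan_MI n v Q = prob_space.mutual_information ?M (exp 1) Q (euc n) fst ?Y"
    unfolding chan_MI_def prob_space.mutual_information_def[OF M.P.prob_space_axioms] split_beta'
    using sets_eq by (intro arg_cong2[where f="KL_divergence (exp 1)"] arg_cong2[where f=pair_measure] distr_cong sets_pair_measure_cong) auto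
  also have "\<dots> = (\<integral>w. gauss_kernel n v (fst w) (snd w) *
      log (exp 1) (gauss_kernel n v (fst w) (snd w) / (1 * ?f (snd w))) \<partial>(Q \<Otimes>\<^sub>M euc n))"
    using gauss_kernel_pos[OF v_pos] out_density_pos
    by (intro I.mutual_information_distr dX dY dXY sigma_finite_measure_axioms L.sigma_finite_measure_axioms)
       (auto intro: less_imp_le)
  also have "\<dots> = (\<integral>w. log (exp 1) (gauss_kernel n v (fst w) (snd w) / (1 * ?f (snd w))) \<partial>joint_law n v Q)"
    unfolding joint_law_def split_beta' using less_imp_le[OF gauss_kernel_pos[OF v_pos]]
    by (subst integral_density) auto
  also have "\<dots> = (\<integral>w. - (real n / 2 * ln (2 * pi * v)) - sqdist n (fst w) (snd w) / (2 * v) - ln (?f (snd w)) \<partial>joint_law n v Q)"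
    using v_pos out_density_pos gauss_kernel_pos[OF v_pos]
    by (intro Bochner_Integration.integral_cong) (auto simp: log_def ln_div ln_gauss_kernel less_imp_neq[symmetric])
  \<comment> \<open>The mean log-kernel is minus the noise entropy
    \<open>n/2 ln (2 pi v) + n/2\<close>, so the sum is \<open>h(Y) - h(N)\<close>.\<close>
  also have "\<dots> = - (real n / 2 * ln (2 * pi * v)) - real n * v / (2 * v) + out_entropy n v Q"
  proof -
    have "integrable (joint_law n v Q) (\<lambda>w. ln (?f (snd w)))"
      using integrable_ln_out_density by (subst (asm) integrable_out_law_iff) auto
    moreover have "(\<integral>w. ln (?f (snd w)) \<partial>joint_law n v Q) = - out_entropy n v Q"
      unfolding out_entropy_def by (subst integral_out_law) auto
    moreover have "integrable (joint_law n v Q) (\<lambda>w. sqdist n (fst w) (snd w))"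
      "(\<integral>w. sqdist n (fst w) (snd w) \<partial>joint_law n v Q) = real n * v"
      using has_bochner_integral_joint_sqdist by (simp_all add: has_bochner_integral_iff)
    ultimately show ?thesis by (simp add: J.prob_space)
  qed
  finally show ?thesis using v_pos by simp
qed

end

section \<open>Secrecy rates of bounded inputs\<close>

lemma admissible_input_channel:
  assumes "admissible_input n R P" "0 \<le> R" "0 < v"
  shows "gaussian_channel P n v" "second_moment n P \<le> R\<^sup>2"
proof -
  interpret prob_space P using assms by (simp add: admissible_input_def)
  have setsP [measurable_cong]: "sets P = sets (euc n)" using assms by (simp add: admissible_input_def)
  have AE: "AE x in P. sqdist n (\<lambda>_. 0) x \<le> R\<^sup>2"
    using assms by (simp add: admissible_input_def vnorm_le_iff)
  have int: "integrable P (\<lambda>x. sqdist n (\<lambda>_. 0) x)"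
    by (rule integrable_const_bound[where B="R\<^sup>2"]) (use AE in \<open>auto simp: sqdist_nonneg\<close>)
  show "gaussian_channel P n v"
    by unfold_locales (use assms int in \<open>auto simp: admissible_input_def\<close>)
  show "second_moment n P \<le> R\<^sup>2"
    unfolding second_moment_def by (rule integral_le_const[OF int AE])
qed

lemma secrecy_rate_eq:
  fixes S :: real
  assumes "0 < v1" "0 < v2" "0 \<le> S"
  shows "ln ((1 + S / v1) / (1 + S / v2)) = (ln (S + v1) - ln v1) - (ln (S + v2) - ln v2)"
proof -
  have "1 + S / v1 = (S + v1) / v1" "1 + S / v2 = (S + v2) / v2"
    using assms by (simp_all add: add_divide_distrib)
  then show ?thesis
    using assms by (simp only: ln_divide_pos divide_pos_pos add_nonneg_pos)
qed

text \<open>The noise entropies are explicit, so bounding the rate from above means bounding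
  \<open>h(Y2) - h(Y1)\<close> from below. The increment inequality does this with \<open>S\<close>
  the power \<open>c^2\<close> and \<open>d = v2 - v1\<close>.\<close>

lemma chan_MI_diff_le:
  assumes "admissible_input n (c * sqrt (real n)) P" "0 \<le> c" "0 < v1" "v1 < v2"
  shows "chan_MI n v1 P - chan_MI n v2 P \<le> real n * (1 / 2 * ln ((1 + c\<^sup>2 / v1) / (1 + c\<^sup>2 / v2)))"
proof -
  have R: "0 \<le> c * sqrt (real n)" using assms by simp
  have v2: "0 < v2" using assms by simp
  interpret A: gaussian_channel P n v1 by (rule admissible_input_channel[OF assms(1) R assms(3)])
  interpret B: gaussian_channel P n v2 by (rule admissible_input_channel[OF assms(1) R v2])
  define S where "S = c\<^sup>2"
  have S: "0 \<le> S" by (simp add: S_def)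
  have "second_moment n P \<le> real n * S"
    using admissible_input_channel(2)[OF assms(1) R assms(3)] by (simp add: S_def power_mult_distrib mult.commute)
  then have "real n / 2 * ln ((S + v2) / (S + v1)) \<le> out_entropy n v2 P - out_entropy n v1 P"
    using A.out_entropy_increment[of "v2 - v1" S] assms S by simp
  also have "ln ((S + v2) / (S + v1)) = ln (S + v2) - ln (S + v1)"
    using assms S v2 by (simp add: ln_div)
  finally have "real n / 2 * (ln (S + v2) - ln (S + v1)) \<le> out_entropy n v2 P - out_entropy n v1 P" .
  moreover have "ln (2 * pi * v1) = ln (2 * pi) + ln v1" "ln (2 * pi * v2) = ln (2 * pi) + ln v2"
    using assms v2 by (simp_all add: ln_mult_pos)
  ultimately show ?thesis
    unfolding A.chan_MI_eq B.chan_MI_eq S_def[symmetric] secrecy_rate_eq[OF assms(3) v2 S]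
    by (simp add: algebra_simps)
qed

text \<open>The three losses against the target rate are visible separately: \<open>t\<close> in
  place of \<open>c^2\<close> in the first entropy, the energy deficit of the input against
  \<open>n t\<close>, and the domination constant \<open>K\<close>.\<close>

lemma chan_MI_diff_ge:
  assumes "admissible_input n (c * sqrt (real n)) P" "0 \<le> c" "0 < v1" "v1 < v2" "0 \<le> t" "0 < K"
    and le: "\<And>y. out_density n v1 P y \<le> K * gauss_kernel n (t + v1) (\<lambda>_. 0) y"
  shows "real n / 2 * ((ln (t + v1) - ln v1) - (ln (c\<^sup>2 + v2) - ln v2)) - (real n * t - second_moment n P) / (2 * (t + v1)) - ln K
    \<le> chan_MI n v1 P - chan_MI n v2 P"
proof -
  have R: "0 \<le> c * sqrt (real n)" using assms by simp
  have v2: "0 < v2" using assms by simp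
  define S where "S = c\<^sup>2"
  have pos: "0 < t + v1" "0 < S + v2" using assms v2 by (auto simp: S_def add_nonneg_pos)
  interpret A: gaussian_channel P n v1 by (rule admissible_input_channel[OF assms(1) R assms(3)])
  interpret B: gaussian_channel P n v2 by (rule admissible_input_channel[OF assms(1) R v2])
  have "second_moment n P + real n * v2 \<le> real n / 2 * (2 * (S + v2))"
    using admissible_input_channel(2)[OF assms(1) R assms(3)] by (simp add: S_def power_mult_distrib algebra_simps)
  then have "(second_moment n P + real n * v2) / (2 * (S + v2)) \<le> real n / 2"
    using pos(2) by (simp only: pos_divide_le_eq mult_pos_pos zero_less_numeral)
  then have "out_entropy n v2 P \<le> real n / 2 * ln (2 * pi * (S + v2)) + real n / 2"
    using B.out_entropy_le[OF pos(2)] by linarith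
  moreover define Z where "Z = (real n * t - second_moment n P) / (2 * (t + v1))"
  have "(second_moment n P + real n * v1) / (2 * (t + v1)) = real n / 2 - Z"
  proof -
    define X where "X = 2 * (t + v1)"
    have eq: "second_moment n P + real n * v1 = real n / 2 * X - (real n * t - second_moment n P)"
      by (simp add: X_def algebra_simps)
    moreover have "X \<noteq> 0" using pos(1) by (simp add: X_def)
    ultimately show ?thesis
      unfolding Z_def X_def[symmetric] eq by (subst diff_divide_distrib) simp
  qed
  then have "real n / 2 * ln (2 * pi * (t + v1)) + (real n / 2 - Z) - ln K \<le> out_entropy n v1 P"
    using A.out_entropy_ge[OF pos(1) assms(6) le] by simp
  moreover have "ln (2 * pi * v1) = ln (2 * pi) + ln v1" "ln (2 * pi * v2) = ln (2 * pi) + ln v2"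
    "ln (2 * pi * (t + v1)) = ln (2 * pi) + ln (t + v1)" "ln (2 * pi * (S + v2)) = ln (2 * pi) + ln (S + v2)"
    using assms v2 pos by (auto intro!: ln_mult_pos simp del: distrib_left_numeral)
  ultimately show ?thesis
    unfolding A.chan_MI_eq B.chan_MI_eq S_def[symmetric] Z_def[symmetric]
    by (simp add: algebra_simps add_divide_distrib)
qed

text \<open>Provides a witness that the set under the supremum is nonempty, and the input used for
  \<open>c = 0\<close>. The origin takes the value \<open>undefined\<close> off
  \<open>{..<n}\<close> so as to lie in \<open>space (euc n)\<close>.\<close>

lemma admissible_input_return:
  assumes "0 \<le> R"
  shows "admissible_input n R (return (euc n) (\<lambda>i. if i < n then 0 else undefined))"
proof -
  have z: "(\<lambda>i. if i < n then 0 else undefined) \<in> space (euc n)"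
    by (auto simp: space_euc extensional_def)
  have [measurable]: "Measurable.pred (euc n) (\<lambda>x. vnorm n x \<le> R)"
    unfolding vnorm_def by measurable
  show ?thesis
    using z assms by (simp add: admissible_input_def prob_space_return AE_return vnorm_def)
qed

text \<open>Expanding the square into a double sum, the \<open>n\<close> diagonal terms have the
  fourth moment \<open>3 t^2\<close> and the others \<open>t^2\<close>. This supplies the variance
  for Chebyshev's inequality.\<close>

lemma nn_integral_gauss_kernel_sqdist_square:
  assumes "0 < t"
  shows "(\<integral>\<^sup>+y. ennreal ((sqdist n (\<lambda>_. 0) y)\<^sup>2) * ennreal (gauss_kernel n t (\<lambda>_. 0) y) \<partial>euc n)
    = ennreal (((real n)\<^sup>2 + 2 * real n) * t\<^sup>2)"
proof -
  \<comment> \<open>Moment contributed by coordinate \<open>k\<close> to the product of the squares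
    at \<open>i\<close> and \<open>j\<close>: one \<open>t\<close> per matching index, with the
    extra factor \<open>3\<close> when both match.\<close>
  let ?m = "\<lambda>i j k. (if k = i then t else 1) * (if k = j then t else 1) * (if k = i then if i = j then 3 else 1 else 1 :: real)"
  have 4: "(\<integral>\<^sup>+x. ennreal (x\<^sup>2) * ennreal (x\<^sup>2) * ennreal (normal_density 0 (sqrt t) x) \<partial>lborel) = ennreal (t * t * 3)"
  proof -
    have "has_bochner_integral lborel (\<lambda>x. normal_density 0 (sqrt t) x * x ^ 4) (fact 4 / ((2 / t)\<^sup>2 * fact 2))"
      using normal_moment_even[of "sqrt t" 0 2] assms by simp
    moreover have "fact 4 / ((2 / t)\<^sup>2 * fact 2) = 3 * t\<^sup>2"
      using assms by (simp add: power_divide fact_numeral)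
    ultimately have *: "has_bochner_integral lborel (\<lambda>x. x\<^sup>2 * x\<^sup>2 * normal_density 0 (sqrt t) x) (3 * t\<^sup>2)"
      by (simp add: mult.commute flip: power_add)
    have "(\<integral>\<^sup>+x. ennreal (x\<^sup>2 * x\<^sup>2 * normal_density 0 (sqrt t) x) \<partial>lborel) = ennreal (3 * t\<^sup>2)"
      using * by (subst nn_integral_eq_integral) (auto simp: has_bochner_integral_iff)
    moreover have "ennreal (x\<^sup>2) * ennreal (x\<^sup>2) * ennreal (normal_density 0 (sqrt t) x) = ennreal (x\<^sup>2 * x\<^sup>2 * normal_density 0 (sqrt t) x)" for x
      by (simp only: ennreal_mult zero_le_power2 normal_density_nonneg mult_nonneg_nonneg)
    moreover have "3 * t\<^sup>2 = t * t * 3" by (simp add: power2_eq_square)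
    ultimately show ?thesis by (simp only:)
  qed
  have 2: "(\<integral>\<^sup>+x. ennreal (x\<^sup>2) * ennreal (normal_density 0 (sqrt t) x) \<partial>lborel) = ennreal t"
    using nn_integral_normal_density_square[OF assms, of 0 0] by simp
  have *: "(\<integral>\<^sup>+y. ennreal ((y i)\<^sup>2 * (y j)\<^sup>2) * ennreal (gauss_kernel n t (\<lambda>_. 0) y) \<partial>euc n)
      = ennreal (t\<^sup>2 * (1 + (if i = j then 2 else 0)))" if ij: "i < n" "j < n" for i j
  proof -
    let ?h = "\<lambda>k x :: real. (if k = i then ennreal (x\<^sup>2) else 1) * (if k = j then ennreal (x\<^sup>2) else 1)"
    have "(\<integral>\<^sup>+y. ennreal ((y i)\<^sup>2 * (y j)\<^sup>2) * ennreal (gauss_kernel n t (\<lambda>_. 0) y) \<partial>euc n)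
      = (\<integral>\<^sup>+y. (\<Prod>k<n. ?h k (y k)) * ennreal (gauss_kernel n t (\<lambda>_. 0) y) \<partial>euc n)"
      using ij by (simp add: prod.distrib ennreal_mult)
    also have "\<dots> = (\<Prod>k<n. \<integral>\<^sup>+x. ?h k x * ennreal (normal_density 0 (sqrt t) x) \<partial>lborel)"
      by (rule nn_integral_gauss_kernel_prod) simp
    also have "\<dots> = (\<Prod>k<n. ennreal (?m i j k))"
    proof (rule prod.cong[OF refl])
      fix k
      show "(\<integral>\<^sup>+x. ?h k x * ennreal (normal_density 0 (sqrt t) x) \<partial>lborel) = ennreal (?m i j k)"
        using assms by (cases "k = i"; cases "k = j") (auto simp: 2 4 nn_integral_normal_density)
    qed
    also have "\<dots> = ennreal (\<Prod>k<n. ?m i j k)"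
      using assms by (intro prod_ennreal) auto
    also have "(\<Prod>k<n. ?m i j k) = t\<^sup>2 * (1 + (if i = j then 2 else 0))"
      using ij by (simp add: prod.distrib power2_eq_square)
    finally show ?thesis .
  qed
  have "(\<integral>\<^sup>+y. ennreal ((sqdist n (\<lambda>_. 0) y)\<^sup>2) * ennreal (gauss_kernel n t (\<lambda>_. 0) y) \<partial>euc n)
     = (\<integral>\<^sup>+y. (\<Sum>i<n. \<Sum>j<n. ennreal ((y i)\<^sup>2 * (y j)\<^sup>2) * ennreal (gauss_kernel n t (\<lambda>_. 0) y)) \<partial>euc n)"
    unfolding sum_distrib_right[symmetric]
    by (simp add: sqdist_def power2_eq_square[of "sum _ _"] sum_product sum_nonneg)
  also have "\<dots> = (\<Sum>i<n. \<integral>\<^sup>+y. (\<Sum>j<n. ennreal ((y i)\<^sup>2 * (y j)\<^sup>2) * ennreal (gauss_kernel n t (\<lambda>_. 0) y)) \<partial>euc n)"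
    by (intro nn_integral_sum) auto
  also have "\<dots> = (\<Sum>i<n. \<Sum>j<n. \<integral>\<^sup>+y. ennreal ((y i)\<^sup>2 * (y j)\<^sup>2) * ennreal (gauss_kernel n t (\<lambda>_. 0) y) \<partial>euc n)"
    by (intro sum.cong refl nn_integral_sum) auto
  also have "\<dots> = (\<Sum>i<n. \<Sum>j<n. ennreal (t\<^sup>2 * (1 + (if i = j then 2 else 0))))"
    by (intro sum.cong refl *) auto
  also have "\<dots> = ennreal (\<Sum>i<n. \<Sum>j<n. t\<^sup>2 * (1 + (if i = j then 2 else 0)))"
    by (simp add: sum_nonneg)
  also have "(\<Sum>i<n. \<Sum>j<n. t\<^sup>2 * (1 + (if i = j then 2 else 0 :: real))) = ((real n)\<^sup>2 + 2 * real n) * t\<^sup>2"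
    by (simp add: sum_distrib_left[symmetric] sum.distrib power2_eq_square algebra_simps)
  finally show ?thesis .
qed

section \<open>From rates of single inputs to the supremum\<close>

lemma Cs_le:
  assumes "0 \<le> c" "0 < v1" "v1 < v2"
  shows "Cs v1 v2 (c * sqrt (real n)) n \<le> real n * (1 / 2 * ln ((1 + c\<^sup>2 / v1) / (1 + c\<^sup>2 / v2)))"
proof -
  have "admissible_input n (c * sqrt (real n)) (return (euc n) (\<lambda>i. if i < n then 0 else undefined))"
    using assms by (intro admissible_input_return) simp
  then show ?thesis
    unfolding Cs_def using chan_MI_diff_le[OF _ assms] by (intro cSup_least) blast+
qed

text \<open>A real \<open>Sup\<close> dominates its elements once the set is bounded above, and that
  bound is \<open>chan_MI_diff_le\<close>.\<close>

lemma Cs_ge: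
  assumes "0 \<le> c" "0 < v1" "v1 < v2" "admissible_input n (c * sqrt (real n)) P"
  shows "chan_MI n v1 P - chan_MI n v2 P \<le> Cs v1 v2 (c * sqrt (real n)) n"
  unfolding Cs_def
proof (rule cSup_upper)
  show "bdd_above ((\<lambda>P. chan_MI n v1 P - chan_MI n v2 P) ` {P. admissible_input n (c * sqrt (real n)) P})"
    using chan_MI_diff_le[OF _ assms(1-3)] by (intro bdd_aboveI2) blast
qed (use assms in blast)

text \<open>For the point mass at the origin the output density is the kernel itself, so the lower
  bound applies with \<open>t = 0\<close> and \<open>K = 1\<close> and every loss vanishes.\<close>

lemma Cs_zero_ge:
  assumes "0 < v1" "v1 < v2"
  shows "0 \<le> Cs v1 v2 (0 * sqrt (real n)) n"
proof -
  let ?P = "return (euc n) (\<lambda>i. if i < n then 0 else undefined)"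
  have adm: "admissible_input n (0 * sqrt (real n)) ?P"
    using admissible_input_return[of 0 n] by simp
  have z: "(\<lambda>i. if i < n then 0 else undefined) \<in> space (euc n)"
    by (auto simp: space_euc extensional_def)
  have "out_density n v1 ?P y = gauss_kernel n v1 (\<lambda>_. 0) y" for y
    unfolding out_density_def using z
    by (subst integral_return) (simp_all, simp add: gauss_kernel_def)
  moreover have "second_moment n ?P = 0"
    unfolding second_moment_def using z by (subst integral_return) (simp_all, simp add: sqdist_def)
  ultimately have "0 \<le> chan_MI n v1 ?P - chan_MI n v2 ?P"
    using chan_MI_diff_ge[OF adm, of v1 v2 0 1] assms by simp
  then show ?thesis
    using Cs_ge[OF _ assms adm] by simp
qed

text \<open>The squared norm of a Gaussian of variance \<open>t\<close> has mean \<open>n t\<close>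
  and variance \<open>2 n t^2\<close>. By Chebyshev the ball has probability at least
  \<open>1/2\<close> for the \<open>n\<close> assumed, so conditioning at most doubles the density,
  and the energy lost is bounded independently of \<open>n\<close>.\<close>

lemma truncated_gaussian_input:
  assumes "0 < c" "0 < t" "t < c\<^sup>2" "0 < v" and n: "4 * t\<^sup>2 / (c\<^sup>2 - t)\<^sup>2 \<le> real n" "0 < n"
  obtains P where "admissible_input n (c * sqrt (real n)) P"
    and "\<And>y. out_density n v P y \<le> 2 * gauss_kernel n (t + v) (\<lambda>_. 0) y"
    and "real n * t - 2 * t\<^sup>2 * (1 / (c\<^sup>2 - t) + t / (c\<^sup>2 - t)\<^sup>2) \<le> second_moment n P"
proof -
  define D where "D = c\<^sup>2 - t"
  define G where "G = gauss_vec n t"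
  define A where "A = {x \<in> space (euc n). vnorm n x \<le> c * sqrt (real n)}"
  define q where "q x = sqdist n (\<lambda>_. 0) x" for x
  have D: "0 < D" using assms by (simp add: D_def)
  have Gd: "G = density (euc n) (\<lambda>y. ennreal (gauss_kernel n t (\<lambda>_. 0) y))"
    unfolding G_def using assms by (intro gauss_vec_eq_density)
  have [measurable_cong]: "sets G = sets (euc n)" by (simp add: Gd)
  interpret G: prob_space G
    using assms by (intro prob_spaceI) (simp add: Gd nn_integral_gauss_kernel emeasure_density)
  have R: "0 \<le> c * sqrt (real n)" using assms by simp
  have [measurable]: "A \<in> sets (euc n)" unfolding A_def vnorm_def by measurable
  have [measurable]: "q \<in> borel_measurable (euc n)" unfolding q_def[abs_def] by measurable
  have A: "x \<in> A \<longleftrightarrow> q x \<le> real n * c\<^sup>2" if "x \<in> space (euc n)" for x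
    using that by (simp add: A_def q_def vnorm_le_iff[OF R] power_mult_distrib mult.commute)
  have q0: "0 \<le> q x" for x by (simp add: q_def sqdist_nonneg)
  have q: "has_bochner_integral G q (real n * t)"
    using assms nn_integral_gauss_kernel_sqdist[OF assms(2), of n "\<lambda>_. 0" "\<lambda>_. 0"]
    by (intro has_bochner_integral_nn_integral)
       (auto simp: q_def sqdist_nonneg Gd nn_integral_density mult.commute sqdist_def[of n "\<lambda>_. 0" "\<lambda>_. 0"])
  have q2: "has_bochner_integral G (\<lambda>x. (q x)\<^sup>2) (((real n)\<^sup>2 + 2 * real n) * t\<^sup>2)"
    using assms nn_integral_gauss_kernel_sqdist_square[OF assms(2), of n]
    by (intro has_bochner_integral_nn_integral)
       (auto simp: Gd nn_integral_density mult.commute q_def)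
  have "has_bochner_integral G (\<lambda>x. (q x)\<^sup>2 - (2 * real n * t) * q x + (real n * t)\<^sup>2)
      (((real n)\<^sup>2 + 2 * real n) * t\<^sup>2 - (2 * real n * t) * (real n * t) + (real n * t)\<^sup>2)"
    by (intro has_bochner_integral_add has_bochner_integral_diff has_bochner_integral_mult_right q q2) (auto simp: has_bochner_integral_iff G.prob_space)
  then have var: "has_bochner_integral G (\<lambda>x. (q x - real n * t)\<^sup>2) (2 * real n * t\<^sup>2)"
    by (simp add: power2_diff algebra_simps power2_eq_square)
  define p where "p = measure G A"
  \<comment> \<open>Off the ball the deviation \<open>d = q x - n t\<close> exceeds
    \<open>n D\<close>. Hence \<open>1 <= d^2 / (n D)^2\<close> and \<open>d <= d^2 / (n D)\<close>,
    and \<open>q x = d + n t\<close> is bounded by a multiple of \<open>d^2\<close>, whose mean is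
    the variance.\<close>
  have cheb: "1 - indicator A x \<le> (q x - real n * t)\<^sup>2 / (real n * D)\<^sup>2"
    and cheb': "q x - q x * indicator A x \<le> (q x - real n * t)\<^sup>2 * ((1 / D + t / D\<^sup>2) / real n)"
    if x: "x \<in> space (euc n)" for x
  proof -
    have "1 - indicator A x \<le> (q x - real n * t)\<^sup>2 / (real n * D)\<^sup>2 \<and>
      q x - q x * indicator A x \<le> (q x - real n * t)\<^sup>2 * ((1 / D + t / D\<^sup>2) / real n)"
    proof (cases "x \<in> A")
      case True
      then show ?thesis using D assms by simp
    next
      case False
      define d where "d = q x - real n * t"
      have d: "real n * D < d" using False A[OF x] by (simp add: d_def D_def algebra_simps)
      have nD: "0 < real n * D" using D n by simp
      have "(real n * D)\<^sup>2 \<le> d\<^sup>2" using d nD by (intro power_mono) auto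
      then have 1: "1 \<le> d\<^sup>2 / (real n * D)\<^sup>2"
        using pos_le_divide_eq[OF zero_less_power[OF nD, of 2], of 1] by simp
      have "real n * D * d \<le> d\<^sup>2" using d nD by (simp add: power2_eq_square)
      then have 2: "d \<le> d\<^sup>2 / (real n * D)" using nD by (simp add: field_simps)
      have "real n * t = real n * t * 1" by simp
      also have "\<dots> \<le> real n * t * (d\<^sup>2 / (real n * D)\<^sup>2)"
        using 1 assms by (intro mult_left_mono) auto
      also have "\<dots> = d\<^sup>2 * (t / D\<^sup>2 / real n)"
        using n D by (simp add: power2_eq_square field_simps)
      finally have "q x \<le> d\<^sup>2 / (real n * D) + d\<^sup>2 * (t / D\<^sup>2 / real n)"
        using 2 by (simp add: d_def)
      also have "\<dots> = d\<^sup>2 * ((1 / D + t / D\<^sup>2) / real n)"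
        by (simp add: add_divide_distrib distrib_left mult.commute)
      finally show ?thesis using False 1 nD by (simp add: d_def)
    qed
    then show "1 - indicator A x \<le> (q x - real n * t)\<^sup>2 / (real n * D)\<^sup>2"
      "q x - q x * indicator A x \<le> (q x - real n * t)\<^sup>2 * ((1 / D + t / D\<^sup>2) / real n)" by auto
  qed
  have sp: "space G = space (euc n)" by (simp add: Gd)
  have ind: "integrable G (\<lambda>x. indicator A x :: real)"
    by (rule G.integrable_const_bound[where B=1]) (auto split: split_indicator)
  have "(\<integral>x. 1 - indicator A x \<partial>G) \<le> (\<integral>x. (q x - real n * t)\<^sup>2 / (real n * D)\<^sup>2 \<partial>G)"
    using var cheb ind by (intro integral_mono) (auto simp: has_bochner_integral_iff sp)
  then have "1 - p \<le> 2 * real n * t\<^sup>2 / (real n * D)\<^sup>2"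
    using var ind by (simp add: has_bochner_integral_iff G.prob_space p_def)
  also have "\<dots> \<le> 1 / 2"
  proof -
    have "4 * t\<^sup>2 \<le> real n * D\<^sup>2" using n D by (simp add: D_def field_simps)
    then have "4 * t\<^sup>2 * real n \<le> real n * D\<^sup>2 * real n" by (intro mult_right_mono) auto
    then show ?thesis using n D by (simp add: field_simps power2_eq_square)
  qed
  finally have p: "1 / 2 \<le> p" by simp
  have p1: "p \<le> 1" by (simp add: p_def)
  define P where "P = density G (\<lambda>x. ennreal (indicator A x / p))"
  have setsP [measurable_cong]: "sets P = sets (euc n)" by (simp add: P_def Gd)
  have "(\<integral>\<^sup>+x. ennreal (indicator A x / p) \<partial>G) = ennreal (\<integral>x. indicator A x / p \<partial>G)"
    using p ind by (intro nn_integral_eq_integral) auto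
  also have "(\<integral>x. indicator A x / p \<partial>G) = 1"
    using p by (simp add: p_def)
  finally have "prob_space P"
    by (intro prob_spaceI) (simp add: P_def emeasure_density)
  moreover have "AE x in P. x \<in> A"
    unfolding P_def
    by (subst AE_density, measurable) (rule AE_I2, simp add: indicator_def)
  then have "AE x in P. vnorm n x \<le> c * sqrt (real n)"
    by (rule AE_mp) (simp add: A_def)
  ultimately have adm: "admissible_input n (c * sqrt (real n)) P"
    by (simp add: admissible_input_def setsP)
  interpret P: gaussian_channel P n v by (rule admissible_input_channel[OF adm R assms(4)])
  show thesis
  proof
    fix y
    have "ennreal (out_density n v P y) = (\<integral>\<^sup>+x. ennreal (indicator A x / p) * ennreal (gauss_kernel n v x y) \<partial>G)"
      unfolding P.ennreal_out_density by (simp add: P_def nn_integral_density)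
    also have "\<dots> \<le> (\<integral>\<^sup>+x. 2 * ennreal (gauss_kernel n v x y) \<partial>G)"
      using p by (intro nn_integral_mono mult_right_mono) (auto split: split_indicator simp: divide_simps ennreal_le_iff2 simp flip: ennreal_numeral)
    also have "\<dots> = 2 * (\<integral>\<^sup>+x. ennreal (gauss_kernel n t (\<lambda>_. 0) x) * ennreal (gauss_kernel n v x y) \<partial>euc n)"
      by (simp add: nn_integral_cmult Gd nn_integral_density)
    also have "\<dots> = ennreal (2 * gauss_kernel n (t + v) (\<lambda>_. 0) y)"
      using assms gauss_kernel_pos[of "t + v" n "\<lambda>_. 0" y] by (simp add: nn_integral_gauss_kernel_conv ennreal_mult)
    finally show "out_density n v P y \<le> 2 * gauss_kernel n (t + v) (\<lambda>_. 0) y"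
      using assms gauss_kernel_pos[of "t + v" n "\<lambda>_. 0" y] by (simp add: ennreal_le_iff)
  next
    have "real n * t - 2 * t\<^sup>2 * (1 / D + t / D\<^sup>2) = (\<integral>x. q x - (q x - real n * t)\<^sup>2 * ((1 / D + t / D\<^sup>2) / real n) \<partial>G)"
      using q var n by (simp add: has_bochner_integral_iff)
    also have "\<dots> \<le> (\<integral>x. indicator A x / p * q x \<partial>G)"
    proof (rule integral_mono)
      have "integrable G (\<lambda>x. indicator A x * q x)"
        using q integrable_mult_indicator[of A G q] by (simp add: has_bochner_integral_iff)
      then show "integrable G (\<lambda>x. indicator A x / p * q x)" by simp
      fix x assume "x \<in> space G"
      then have "q x - (q x - real n * t)\<^sup>2 * ((1 / D + t / D\<^sup>2) / real n) \<le> indicator A x * q x"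
        using cheb'[of x] by (simp add: sp mult.commute)
      \<comment> \<open>Conditioning divides by \<open>p <= 1\<close>, which can only raise the
        energy inside the ball; just the part outside has to be charged as a loss.\<close>
      also have "\<dots> \<le> indicator A x / p * q x"
        using p p1 q0 by (intro mult_right_mono) (auto split: split_indicator)
      finally show "q x - (q x - real n * t)\<^sup>2 * ((1 / D + t / D\<^sup>2) / real n) \<le> indicator A x / p * q x" .
    qed (use q var in \<open>auto simp: has_bochner_integral_iff\<close>)
    also have "\<dots> = second_moment n P"
      unfolding second_moment_def P_def q_def[symmetric] using p by (subst integral_density) auto
    finally show "real n * t - 2 * t\<^sup>2 * (1 / (c\<^sup>2 - t) + t / (c\<^sup>2 - t)\<^sup>2) \<le> second_moment n P"
      by (simp add: D_def)
  qed (fact adm)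
qed

section \<open>The limit of the normalised secrecy capacity\<close>

theorem theorem7:
  fixes v1 v2 c :: real
  assumes "0 < v1" and "v1 < v2"
    and "assumption_A"
    and "0 \<le> c" and "c \<le> cstar v1 v2"
  shows "(\<lambda>n. Cs v1 v2 (c * sqrt (real n)) n / real n)
           \<longlonglongrightarrow> 1 / 2 * ln ((1 + c\<^sup>2 / v1) / (1 + c\<^sup>2 / v2))"
    (is "_ \<longlonglongrightarrow> ?L")
proof (rule order_tendstoI)
  fix a assume "?L < a"
  moreover have "Cs v1 v2 (c * sqrt (real n)) n / real n \<le> ?L" if "1 \<le> n" for n
    using Cs_le[OF assms(4,1,2), of n] that by (simp only: pos_divide_le_eq of_nat_0_less_iff) (simp add: mult.commute)
  ultimately show "\<forall>\<^sub>F n in sequentially. Cs v1 v2 (c * sqrt (real n)) n / real n < a"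
    by (intro eventually_sequentiallyI[of 1]) (rule le_less_trans)
next
  fix a assume a: "a < ?L"
  show "\<forall>\<^sub>F n in sequentially. a < Cs v1 v2 (c * sqrt (real n)) n / real n"
  \<comment> \<open>For \<open>c = 0\<close> the limit is \<open>0\<close> and no \<open>t\<close>
    lies strictly between \<open>0\<close> and \<open>c^2\<close>, so the point mass takes the place
    of the conditioned Gaussian.\<close>
  proof (cases "c = 0")
    case True
    then show ?thesis
      using a Cs_zero_ge[OF assms(1,2)] by (auto intro!: always_eventually intro: less_le_trans)
  next
    case False
    then have c: "0 < c" using assms by simp
    have v2: "0 < v2" using assms by simp
    \<comment> \<open>Rate per dimension guaranteed by variance \<open>t\<close>, before the losses
      of order \<open>1 / n\<close>. Continuity at \<open>c^2\<close>, where it equals the limit,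
      allows a fixed \<open>t < c^2\<close> that still beats \<open>a\<close>.\<close>
    define g where "g t = 1 / 2 * ((ln (t + v1) - ln v1) - (ln (c\<^sup>2 + v2) - ln v2))" for t
    have pos: "0 < c\<^sup>2 + v1" using assms by (simp add: add_nonneg_pos)
    have L: "?L = g (c\<^sup>2)"
      unfolding g_def using secrecy_rate_eq[OF assms(1) v2, of "c\<^sup>2"] by simp
    have "(g \<longlongrightarrow> g (c\<^sup>2)) (at_left (c\<^sup>2))"
      unfolding g_def[abs_def] using pos assms by (auto intro!: tendsto_eq_intros)
    then have "\<forall>\<^sub>F t in at_left (c\<^sup>2). a < g t"
      using a unfolding L by (rule order_tendstoD)
    moreover have "\<forall>\<^sub>F t in at_left (c\<^sup>2). t \<in> {0<..<c\<^sup>2}"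
      using c by (intro eventually_at_leftI[of 0]) auto
    ultimately have "\<forall>\<^sub>F t in at_left (c\<^sup>2). a < g t \<and> t \<in> {0<..<c\<^sup>2}"
      by (rule eventually_conj)
    then obtain t where t: "a < g t" "0 < t" "t < c\<^sup>2"
      using eventually_happens[of _ "at_left (c\<^sup>2)"] by auto
    \<comment> \<open>Energy deficit plus \<open>ln K\<close> with \<open>K = 2\<close>. It depends
      on \<open>t\<close> but not on \<open>n\<close>, so it disappears after division by
      \<open>n\<close>.\<close>
    define E where "E = 2 * t\<^sup>2 * (1 / (c\<^sup>2 - t) + t / (c\<^sup>2 - t)\<^sup>2) / (2 * (t + v1)) + ln 2"
    have "(\<lambda>n. g t - E / real n) \<longlonglongrightarrow> g t - 0"
      by (intro tendsto_intros lim_const_over_n)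
    then have "\<forall>\<^sub>F n in sequentially. a < g t - E / real n"
      using t by (intro order_tendstoD(1)) auto
    moreover have "\<forall>\<^sub>F n in sequentially. 4 * t\<^sup>2 / (c\<^sup>2 - t)\<^sup>2 \<le> real n"
      using filterlim_real_sequentially by (simp add: filterlim_at_top)
    moreover have "\<forall>\<^sub>F n in sequentially. 0 < n"
      by (rule eventually_gt_at_top)
    ultimately show ?thesis
    proof eventually_elim
      case (elim n)
      obtain P where P: "admissible_input n (c * sqrt (real n)) P"
        "\<And>y. out_density n v1 P y \<le> 2 * gauss_kernel n (t + v1) (\<lambda>_. 0) y"
        "real n * t - 2 * t\<^sup>2 * (1 / (c\<^sup>2 - t) + t / (c\<^sup>2 - t)\<^sup>2) \<le> second_moment n P"
        using truncated_gaussian_input[OF c t(2,3) assms(1) elim(2,3)] by metis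
      have "(real n * t - second_moment n P) / (2 * (t + v1)) \<le> E - ln 2"
        unfolding E_def using P(3) t assms by (simp add: divide_right_mono)
      then have "real n * g t - E \<le> chan_MI n v1 P - chan_MI n v2 P"
        using chan_MI_diff_ge[OF P(1) assms(4,1,2) _ _ P(2)] t by (simp add: g_def)
      then have "real n * g t - E \<le> Cs v1 v2 (c * sqrt (real n)) n"
        using Cs_ge[OF assms(4,1,2) P(1)] by linarith
      then have "g t - E / real n \<le> Cs v1 v2 (c * sqrt (real n)) n / real n"
        using elim(3) divide_right_mono[of "real n * g t - E" _ "real n"] by (fastforce simp: diff_divide_distrib)
      then show ?case using elim(1) by linarith
    qed
  qed
qed

end
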